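(* Let $Q$ be an ergodic upper block-Hessenberg $Q$-matrix on $\mathbb{S}=\bigcup_{k\ge 0}\{k\}\times\mathbb{M}_k$ with stationary distribution vector $\pi=(\pi_0,\pi_1,\dots)$, let $\mathbb{K}\subset\mathbb{Z}_+$ be finite and nonempty, and let $K=\max\mathbb{K}$. For each integer $n\ge K$, let $j_n^*$ be any element of $$\mathbb{J}_n^*:=\operatorname*{arg\,max}_{j\in\mathbb{I}_n^+}\frac{u_{n,\mathbb{K}}^*(j)}{u_n^*(j)},$$ let $\alpha_n^*$ be the $1\times M_n$ unit row vector with $\alpha_n^*(j_n^* )=1$ and all other entries $0$, and define the vector ${}_{(n)}\widehat{\pi}^*=({}_{(n)}\widehat{\pi}_0^*,\dots,{}_{(n)}\widehat{\pi}_n^* )$ by $${}_{(n)}\widehat{\pi}_k^*=\frac{\alpha_n^*U_{n,k}^*}{\alpha_n^*u_n^*}=\frac{\mathrm{row}_{j_n^*}(U_{n,k}^* )}{u_n^*(j_n^* )},\qquad k=0,1,\dots,n,$$ where $\mathrm{row}_j(\cdot)$ denotes the $j$-th row of a matrix. Then $$\lim_{n\to\infty}\bigl\|{}_{(n)}\widehat{\pi}^*-\pi\bigr\|_1=0,$$ and therefore $$\pi=\lim_{n\to\infty}\left(\frac{\alpha_n^*U_{n,k}^*}{\alpha_n^*u_n^*}\right)_{k=0,\dots,n}=\lim_{n\to\infty}\left(\frac{\alpha_n^*U_n^*\,(U_{n-1}U_{n-2}\cdots U_k)}{\alpha_n^*U_n^*\sum_{\ell=0}^n (U_{n-1}U_{n-2}\cdots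 U_\ell)\,e}\right)_{k=0,\dots,n}.$$
   Context: Notation: $\mathbb{Z}_+=\{0,1,2,\dots\}$; $e$ is a column vector of ones of appropriate dimension. The state space is $\mathbb{S}=\bigcup_{k\in\mathbb{Z}_+}\mathbb{L}_k$, with levels $\mathbb{L}_k=\{k\}\times\mathbb{M}_k$, $\mathbb{M}_k=\{1,\dots,M_k\}$, $1\le M_k<\infty$. $Q=(q(k,i;\ell,j))$ is an essential $Q$-matrix on $\mathbb{S}$: diagonal entries are finite and strictly negative, off-diagonal entries are finite and nonnegative, and every row sums to $0$. It is of upper block-Hessenberg form: with $Q_{k,\ell}$ the $M_k\times M_\ell$ block of rows in $\mathbb{L}_k$ and columns in $\mathbb{L}_\ell$, $Q_{k,\ell}=O$ whenever $\ell\le k-2$. $Q$ is assumed ergodic, i.e. irreducible and positive recurrent (irreducibility and recurrence are those of the embedded transition probability matrix $P=I+\mathrm{diag}\{-Q\}^{-1}Q$, where $\mathrm{diag}\{-Q\}$ is the diagonal matrix with the diagonal of $-Q$; positive recurrent means recurrent with a summable invariant measure). Let $\pi$ be its unique stationary distribution vector: $\pi Q=0$, $\pi e=1$, $\pi>0$, partitioned by level as $\pi=(\pi_0,\pi_1,\dots)$. The $M_n\times M_n$ matrices $U_n^*$ are defined recursively by $U_0^*=(-Q_{0,0})^{-1}$ and, for $n\ge1$, $$U_n^*=\Bigl[-Q_{n,n}-\sum_{\ell=0}^{n-1}(Q_{n,n-1}U_{n-1}^* )(Q_{n-1,n-2}U_{n-2}^* )\cdots(Q_{\ell+1,\ell}U_\ell^*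 )\,Q_{\ell,n}\Bigr]^{-1}$$ (these inverses exist; the $(i,j)$ entry of $U_n^*$ is the expected total sojourn time in state $(n,j)$ before the first visit to levels above $n$, starting from $(n,i)$). Put $U_m=Q_{m+1,m}U_m^*$ for $m\ge0$, and for $0\le k\le n$, $$U_{n,k}^*=U_n^*\,U_{n-1}U_{n-2}\cdots U_k,$$ where the product $U_{n-1}\cdots U_k$ is the identity if $k=n$. Define the column vectors (indexed by $\mathbb{M}_n$) $u_n^*=\sum_{\ell=0}^nU_{n,\ell}^*e$, which is strictly positive, and, for $n\ge K$, $u_{n,\mathbb{K}}^*=\sum_{\ell\in\mathbb{K}}U_{n,\ell}^*e$. Define the (nonempty) set $\mathbb{I}_n^+=\{j\in\mathbb{M}_n:(e^\top Q_{n+1,n})_j>0\}$. The $\ell_1$-distance $\|\cdot\|_1$ between vectors of different dimension is computed after extending the shorter vector by zeros (a vector indexed by levels $0,\dots,n$ is extended by zeros on levels above $n$). Limits of such vectors are in this sense. *)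

theory Defs
  imports
    "HOL-Analysis.Infinite_Sum"
    "Jordan_Normal_Form.Gauss_Jordan_Elimination"
begin

text \<open>
  A state is a pair (level, phase). Phases are numbered from 0, so that level \<open>k\<close> is
  \<open>{k} \<times> {0..<M k}\<close> and the blocks of \<open>Q\<close> are matrices with the usual 0-based indices.
  Values of \<open>q\<close> and \<open>\<pi>\<close> outside the state space are never used.
\<close>

definition state_space :: "(nat \<Rightarrow> nat) \<Rightarrow> (nat \<times> nat) set" where
  "state_space M = (SIGMA k:UNIV. {..<M k})"


section \<open>Q-matrices and ergodicity\<close>

definition essential_Q_matrix :: "'s set \<Rightarrow> ('s \<Rightarrow> 's \<Rightarrow> real) \<Rightarrow> bool" where
  "essential_Q_matrix S q \<longleftrightarrow>
     (\<forall>x\<in>S. q x x < 0) \<and>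
     (\<forall>x\<in>S. \<forall>y\<in>S. x \<noteq> y \<longrightarrow> 0 \<le> q x y) \<and>
     (\<forall>x\<in>S. ((\<lambda>y. q x y) has_sum 0) S)"

definition upper_block_hessenberg ::
    "(nat \<Rightarrow> nat) \<Rightarrow> (nat \<times> nat \<Rightarrow> nat \<times> nat \<Rightarrow> real) \<Rightarrow> bool" where
  "upper_block_hessenberg M q \<longleftrightarrow>
     (\<forall>k l. l + 2 \<le> k \<longrightarrow> (\<forall>i<M k. \<forall>j<M l. q (k, i) (l, j) = 0))"

text \<open>\<open>P = I + diag{-Q}\<^sup>-\<^sup>1 Q\<close>\<close>

definition embedded_chain :: "('s \<Rightarrow> 's \<Rightarrow> real) \<Rightarrow> 's \<Rightarrow> 's \<Rightarrow> real" where
  "embedded_chain q x y = (if x = y then 1 else 0) + inverse (- q x x) * q x y"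

primrec step_prob :: "'s set \<Rightarrow> ('s \<Rightarrow> 's \<Rightarrow> real) \<Rightarrow> nat \<Rightarrow> 's \<Rightarrow> 's \<Rightarrow> real" where
  "step_prob S P 0 x y = (if x = y then 1 else 0)"
| "step_prob S P (Suc n) x y = (\<Sum>\<^sub>\<infinity>z\<in>S. P x z * step_prob S P n z y)"

text \<open>
  The probability that the chain started at \<open>x\<close> makes its first visit to \<open>y\<close> after time 0
  at time \<open>n + 1\<close>.
\<close>

primrec first_visit_prob :: "'s set \<Rightarrow> ('s \<Rightarrow> 's \<Rightarrow> real) \<Rightarrow> nat \<Rightarrow> 's \<Rightarrow> 's \<Rightarrow> real" where
  "first_visit_prob S P 0 x y = P x y"
| "first_visit_prob S P (Suc n) x y =
     (\<Sum>\<^sub>\<infinity>z\<in>S - {y}. P x z * first_visit_prob S P n z y)"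

definition irreducible_chain :: "'s set \<Rightarrow> ('s \<Rightarrow> 's \<Rightarrow> real) \<Rightarrow> bool" where
  "irreducible_chain S P \<longleftrightarrow> (\<forall>x\<in>S. \<forall>y\<in>S. \<exists>n. 0 < step_prob S P n x y)"

definition recurrent_chain :: "'s set \<Rightarrow> ('s \<Rightarrow> 's \<Rightarrow> real) \<Rightarrow> bool" where
  "recurrent_chain S P \<longleftrightarrow> (\<forall>x\<in>S. (\<lambda>n. first_visit_prob S P n x x) sums 1)"

text \<open>Invariance is with respect to \<open>Q\<close>, that is \<open>\<mu> Q = 0\<close>, not with respect to the embedded chain.\<close>

definition invariant_measure :: "'s set \<Rightarrow> ('s \<Rightarrow> 's \<Rightarrow> real) \<Rightarrow> ('s \<Rightarrow> real) \<Rightarrow> bool" where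
  "invariant_measure S q \<mu> \<longleftrightarrow>
     (\<forall>x\<in>S. 0 \<le> \<mu> x) \<and> (\<exists>x\<in>S. \<mu> x \<noteq> 0) \<and>
     (\<forall>y\<in>S. ((\<lambda>x. \<mu> x * q x y) has_sum 0) S)"

definition ergodic_Q :: "'s set \<Rightarrow> ('s \<Rightarrow> 's \<Rightarrow> real) \<Rightarrow> bool" where
  "ergodic_Q S q \<longleftrightarrow>
     irreducible_chain S (embedded_chain q) \<and>
     recurrent_chain S (embedded_chain q) \<and>
     (\<exists>\<mu>. invariant_measure S q \<mu> \<and> \<mu> summable_on S)"

definition stationary_distribution ::
    "'s set \<Rightarrow> ('s \<Rightarrow> 's \<Rightarrow> real) \<Rightarrow> ('s \<Rightarrow> real) \<Rightarrow> bool" where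
  "stationary_distribution S q \<pi> \<longleftrightarrow>
     (\<forall>x\<in>S. 0 < \<pi> x) \<and> (\<pi> has_sum 1) S \<and>
     (\<forall>y\<in>S. ((\<lambda>x. \<pi> x * q x y) has_sum 0) S)"


section \<open>The matrices \<open>U\<^sub>n\<^sup>*\<close> and the associated vectors\<close>

definition ones_vec :: "nat \<Rightarrow> real vec" where
  "ones_vec m = vec m (\<lambda>_. 1)"

definition row_vec_mult :: "real vec \<Rightarrow> real mat \<Rightarrow> real vec" where
  "row_vec_mult v A = transpose_mat A *\<^sub>v v"

definition Q_block ::
    "(nat \<Rightarrow> nat) \<Rightarrow> (nat \<times> nat \<Rightarrow> nat \<times> nat \<Rightarrow> real) \<Rightarrow> nat \<Rightarrow> nat \<Rightarrow> real mat" where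
  "Q_block M q k l = mat (M k) (M l) (\<lambda>(i, j). q (k, i) (l, j))"

text \<open>
  \<open>down_prod M F n k = F (n - 1) * F (n - 2) * \<dots> * F k\<close>, where \<open>F m\<close> is of size
  \<open>M (m + 1) \<times> M m\<close>; it is the identity matrix of size \<open>M k\<close> for \<open>k = n\<close>.
\<close>

definition down_prod :: "(nat \<Rightarrow> nat) \<Rightarrow> (nat \<Rightarrow> real mat) \<Rightarrow> nat \<Rightarrow> nat \<Rightarrow> real mat" where
  "down_prod M F n k = foldr (\<lambda>m A. F m * A) (rev [k..<n]) (1\<^sub>m (M k))"

lemma down_prod_cong [fundef_cong]:
  assumes "M = M'" "n = n'" "k = k'" "\<And>m. m < n' \<Longrightarrow> F m = G m"
  shows "down_prod M F n k = down_prod M' G n' k'"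
  unfolding down_prod_def using assms by (intro foldr_cong) auto

lemma down_prod_refl: "down_prod M F n n = 1\<^sub>m (M n)"
  by (simp add: down_prod_def)

lemma down_prod_Suc: "k \<le> n \<Longrightarrow> down_prod M F (Suc n) k = F n * down_prod M F n k"
  by (simp add: down_prod_def)

text \<open>
  The matrix sum over \<open>l < n\<close> is taken entrywise, because the type of matrices of all sizes
  has no neutral element of addition. For \<open>n = 0\<close> the sum is the zero matrix, see
  \<open>U_star_0\<close> below.
\<close>

function U_star ::
    "(nat \<Rightarrow> nat) \<Rightarrow> (nat \<times> nat \<Rightarrow> nat \<times> nat \<Rightarrow> real) \<Rightarrow> nat \<Rightarrow> real mat" where
  "U_star M q n = the (mat_inverse (- Q_block M q n n -
     mat (M n) (M n) (\<lambda>ij. \<Sum>l<n.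
       (down_prod M (\<lambda>m. Q_block M q (m + 1) m * U_star M q m) n l * Q_block M q l n) $$ ij)))"
  by pat_completeness auto
termination by (relation "measure (\<lambda>(M, q, n). n)") auto

declare U_star.simps [simp del]

lemma U_star_0: "U_star M q 0 = the (mat_inverse (- Q_block M q 0 0))"
proof -
  have "- Q_block M q 0 0 - mat (M 0) (M 0) (\<lambda>_. 0) = - Q_block M q 0 0"
    by (rule eq_matI) (auto simp: Q_block_def)
  then show ?thesis by (subst U_star.simps) simp
qed

definition U_mat ::
    "(nat \<Rightarrow> nat) \<Rightarrow> (nat \<times> nat \<Rightarrow> nat \<times> nat \<Rightarrow> real) \<Rightarrow> nat \<Rightarrow> real mat" where
  "U_mat M q m = Q_block M q (m + 1) m * U_star M q m"

definition U_star2 ::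
    "(nat \<Rightarrow> nat) \<Rightarrow> (nat \<times> nat \<Rightarrow> nat \<times> nat \<Rightarrow> real) \<Rightarrow> nat \<Rightarrow> nat \<Rightarrow> real mat" where
  "U_star2 M q n k = U_star M q n * down_prod M (U_mat M q) n k"

text \<open>\<open>\<Sum>\<^sub>l\<^sub>\<in>\<^sub>L U\<^sub>n\<^sub>,\<^sub>l\<^sup>* e\<close>, used for \<open>L = {0..n}\<close> and for the given finite set of levels.\<close>

definition u_star_on ::
    "(nat \<Rightarrow> nat) \<Rightarrow> (nat \<times> nat \<Rightarrow> nat \<times> nat \<Rightarrow> real) \<Rightarrow> nat set \<Rightarrow> nat \<Rightarrow> real vec" where
  "u_star_on M q L n = vec (M n) (\<lambda>i. \<Sum>l\<in>L. (U_star2 M q n l *\<^sub>v ones_vec (M l)) $ i)"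

definition u_star ::
    "(nat \<Rightarrow> nat) \<Rightarrow> (nat \<times> nat \<Rightarrow> nat \<times> nat \<Rightarrow> real) \<Rightarrow> nat \<Rightarrow> real vec" where
  "u_star M q n = u_star_on M q {0..n} n"

definition I_plus ::
    "(nat \<Rightarrow> nat) \<Rightarrow> (nat \<times> nat \<Rightarrow> nat \<times> nat \<Rightarrow> real) \<Rightarrow> nat \<Rightarrow> nat set" where
  "I_plus M q n =
     {j. j < M n \<and> 0 < row_vec_mult (ones_vec (M (n + 1))) (Q_block M q (n + 1) n) $ j}"

definition J_star ::
    "(nat \<Rightarrow> nat) \<Rightarrow> (nat \<times> nat \<Rightarrow> nat \<times> nat \<Rightarrow> real) \<Rightarrow> nat set \<Rightarrow> nat \<Rightarrow> nat set" where
  "J_star M q L n =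
     {j. is_arg_max (\<lambda>j. u_star_on M q L n $ j / u_star M q n $ j) (\<lambda>j. j \<in> I_plus M q n) j}"

text \<open>The level-\<open>k\<close> block of the approximation; \<open>\<alpha>\<close> is a row vector of dimension \<open>M n\<close>.\<close>

definition pi_hat ::
    "(nat \<Rightarrow> nat) \<Rightarrow> (nat \<times> nat \<Rightarrow> nat \<times> nat \<Rightarrow> real) \<Rightarrow> nat \<Rightarrow> real vec \<Rightarrow> nat \<Rightarrow> real vec" where
  "pi_hat M q n \<alpha> k = (1 / (\<alpha> \<bullet> u_star M q n)) \<cdot>\<^sub>v row_vec_mult \<alpha> (U_star2 M q n k)"


section \<open>Distance of vectors with different numbers of levels\<close>

text \<open>The vector \<open>(v 0, \<dots>, v n)\<close>, extended by zeros on the levels above \<open>n\<close>.\<close>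

definition zero_extend :: "nat \<Rightarrow> (nat \<Rightarrow> real vec) \<Rightarrow> nat \<times> nat \<Rightarrow> real" where
  "zero_extend n v = (\<lambda>(k, i). if k \<le> n then v k $ i else 0)"

text \<open>Valued in \<open>ennreal\<close>, so that a divergent sum is \<open>\<infinity>\<close> and not a default value.\<close>

definition l1_dist :: "'s set \<Rightarrow> ('s \<Rightarrow> real) \<Rightarrow> ('s \<Rightarrow> real) \<Rightarrow> ennreal" where
  "l1_dist S a b = (\<Sum>\<^sub>\<infinity>x\<in>S. ennreal \<bar>a x - b x\<bar>)"

end

theory Submission
  imports Defs "Jordan_Normal_Form.Determinant" "HOL-Analysis.Function_Topology"
begin

text \<open>
  Row \<open>j\<close> of \<open>(U\<^sub>n\<^sub>,\<^sub>0\<^sup>*, \<dots>, U\<^sub>n\<^sub>,\<^sub>n\<^sup>*)\<close> solves \<open>x Q = - e\<^sub>(\<^sub>n\<^sub>,\<^sub>j\<^sub>)\<close> on the levels up to \<open>n\<close>. Hence the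
  normalized rows satisfy the balance equations of all levels below \<open>n\<close>, and \<open>(\<pi>\<^sub>0, \<dots>, \<pi>\<^sub>n)\<close> is a
  nonnegative combination of the rows with \<open>j\<close> in \<open>I_plus\<close>. The choice of \<open>j\<^sub>n\<^sup>*\<close> therefore makes the
  mass of the approximation on the levels in \<open>K\<close> at least that of \<open>\<pi>\<close>. Because the columns of \<open>Q\<close>
  have finite support, the balance equations survive pointwise limits, so every subsequential limit
  is a subprobability invariant measure, i.e. \<open>c \<pi>\<close> with \<open>c \<le> 1\<close> (uniqueness uses recurrence). The
  mass on \<open>K\<close> forces \<open>c \<ge> 1\<close>, and pointwise convergence to \<open>\<pi>\<close> improves to \<open>l\<^sub>1\<close> by Scheffe's lemma.
\<close>

section \<open>Balance equations on the truncated state space\<close>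

definition levels_upto :: "(nat \<Rightarrow> nat) \<Rightarrow> nat \<Rightarrow> (nat \<times> nat) set" where
  "levels_upto M n = (SIGMA k:{..n}. {..<M k})"

lemma finite_levels_upto [simp]: "finite (levels_upto M n)"
  by (simp add: levels_upto_def)

lemma levels_upto_mono: "m \<le> n \<Longrightarrow> levels_upto M m \<subseteq> levels_upto M n"
  by (auto simp: levels_upto_def)

lemma levels_upto_subset: "levels_upto M n \<subseteq> state_space M"
  by (auto simp: levels_upto_def state_space_def)

lemma levels_upto_iff: "x \<in> levels_upto M n \<longleftrightarrow> x \<in> state_space M \<and> fst x \<le> n"
  by (cases x) (auto simp: levels_upto_def state_space_def)

lemma sum_levels_upto:
  "(\<Sum>x\<in>levels_upto M n. f x) = (\<Sum>k\<le>n. \<Sum>i<M k. f (k, i))"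
  by (simp add: levels_upto_def sum.Sigma)

locale hessenberg_chain =
  fixes M :: "nat \<Rightarrow> nat"
    and q :: "nat \<times> nat \<Rightarrow> nat \<times> nat \<Rightarrow> real"
    and \<pi> :: "nat \<times> nat \<Rightarrow> real"
  assumes M_pos: "1 \<le> M k"
    and Q_matrix: "essential_Q_matrix (state_space M) q"
    and hessenberg: "upper_block_hessenberg M q"
    and ergodic: "ergodic_Q (state_space M) q"
    and stationary: "stationary_distribution (state_space M) q \<pi>"
begin

abbreviation "S \<equiv> state_space M"
abbreviation "L \<equiv> levels_upto M"
abbreviation "P \<equiv> embedded_chain q"

lemma q_neg: "x \<in> S \<Longrightarrow> q x x < 0"
  using Q_matrix by (simp add: essential_Q_matrix_def)

lemma q_nonneg: "x \<in> S \<Longrightarrow> y \<in> S \<Longrightarrow> x \<noteq> y \<Longrightarrow> 0 \<le> q x y"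
  using Q_matrix by (simp add: essential_Q_matrix_def)

lemma q_hessenberg: "x \<in> S \<Longrightarrow> y \<in> S \<Longrightarrow> Suc (fst y) < fst x \<Longrightarrow> q x y = 0"
  using hessenberg by (cases x; cases y) (auto simp: upper_block_hessenberg_def state_space_def)

lemma pi_pos: "x \<in> S \<Longrightarrow> 0 < \<pi> x"
  using stationary by (simp add: stationary_distribution_def)

text \<open>Downward jumps cross only one level, so rows above level \<open>Suc (fst y)\<close> have
  no entry in column \<open>y\<close>.\<close>

lemma sum_column_truncate:
  assumes "y \<in> S" "Suc (fst y) \<le> n"
  shows "(\<Sum>x\<in>L n. \<mu> x * q x y) = (\<Sum>x\<in>L (Suc (fst y)). \<mu> x * q x y)"
  using assms q_hessenberg[of _ y] levels_upto_mono[OF assms(2)]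
  by (intro sum.mono_neutral_right) (auto simp: levels_upto_iff not_le)

text \<open>Columns of \<open>q\<close> have finite support, so that balance equations are finite sums.\<close>

definition balanced :: "(nat \<times> nat \<Rightarrow> real) \<Rightarrow> nat \<times> nat \<Rightarrow> bool" where
  "balanced \<mu> y \<longleftrightarrow> (\<Sum>x\<in>L (Suc (fst y)). \<mu> x * q x y) = 0"

lemma balanced_pi: assumes "y \<in> S" shows "balanced \<pi> y"
proof -
  have "((\<lambda>x. \<pi> x * q x y) has_sum 0) S"
    using stationary assms by (simp add: stationary_distribution_def)
  moreover have "((\<lambda>x. \<pi> x * q x y) has_sum 0) S \<longleftrightarrow>
      ((\<lambda>x. \<pi> x * q x y) has_sum 0) (L (Suc (fst y)))"
    using assms q_hessenberg[of _ y]
    by (intro has_sum_cong_neutral) (auto simp: levels_upto_iff not_le)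
  ultimately have "((\<lambda>x. \<pi> x * q x y) has_sum 0) (L (Suc (fst y)))" by simp
  from has_sum_unique[OF this has_sum_finite] show ?thesis by (simp add: balanced_def)
qed

section \<open>The embedded chain and backward propagation along transitions\<close>

lemma embedded_chain_eq:
  assumes "x \<in> S" shows "P x y = (if x = y then 0 else q x y / (- q x x))"
  using q_neg[OF assms] by (auto simp: embedded_chain_def field_simps)

lemma embedded_chain_nonneg: "x \<in> S \<Longrightarrow> y \<in> S \<Longrightarrow> 0 \<le> P x y"
  using q_neg[of x] q_nonneg[of x y]
  by (auto simp: embedded_chain_eq divide_nonneg_neg)

lemma embedded_chain_hessenberg:
  "x \<in> S \<Longrightarrow> y \<in> S \<Longrightarrow> Suc (fst y) < fst x \<Longrightarrow> P x y = 0"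
  using q_hessenberg[of x y] by (auto simp: embedded_chain_eq)

lemma step_prob_nonneg: "x \<in> S \<Longrightarrow> y \<in> S \<Longrightarrow> 0 \<le> step_prob S P n x y"
  by (induction n arbitrary: x)
    (auto intro!: infsum_nonneg mult_nonneg_nonneg embedded_chain_nonneg)

text \<open>Irreducibility in the form used below: every state has a path into \<open>y\<close>, and
  induction on its length pulls the starting state into \<open>Z\<close>. Closedness refers to
  \<open>q\<close>, so that the zero set of a measure can serve as \<open>Z\<close>.\<close>

lemma backward_closed_imp_all:
  assumes "y \<in> Z" "Z \<subseteq> S"
    and closed: "\<And>x y. y \<in> Z \<Longrightarrow> x \<in> S \<Longrightarrow> 0 < q x y \<Longrightarrow> x \<in> Z"
  shows "Z = S"
proof -
  have reach: "x \<in> Z" if "0 < step_prob S P n x y" "x \<in> S" for n x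
    using that
  proof (induction n arbitrary: x)
    case 0
    then show ?case using assms(1) by (auto split: if_splits)
  next
    case (Suc n)
    have "\<not> (\<forall>z\<in>S. P x z * step_prob S P n z y = 0)"
    proof
      assume "\<forall>z\<in>S. P x z * step_prob S P n z y = 0"
      then have "(\<Sum>\<^sub>\<infinity>z\<in>S. P x z * step_prob S P n z y) = 0"
        by (intro infsum_0) auto
      with Suc.prems show False by simp
    qed
    then obtain z where z: "z \<in> S" "P x z \<noteq> 0" "step_prob S P n z y \<noteq> 0" by auto
    then have "z \<in> Z"
      using Suc.IH[of z] step_prob_nonneg[of z y n] assms(1,2) by force
    moreover have "0 < q x z"
      using z Suc.prems q_nonneg[of x z] embedded_chain_eq[of x z] by (force split: if_splits)
    ultimately show ?case using closed Suc.prems by blast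
  qed
  have "irreducible_chain S P" using ergodic by (simp add: ergodic_Q_def)
  then show ?thesis using assms(1,2) reach by (force simp: irreducible_chain_def)
qed

text \<open>The diagonal term is the only one that could be negative, and \<open>\<mu> y = 0\<close>
  removes it. A sum of nonnegative terms that is at most 0 vanishes term by term.\<close>

lemma zero_propagates_backward:
  assumes y: "y \<in> L n" and nonneg: "\<And>x. x \<in> L (Suc n) \<Longrightarrow> 0 \<le> \<mu> x" and "\<mu> y = 0"
    and le: "(\<Sum>x\<in>L (Suc n). \<mu> x * q x y) \<le> 0"
    and x: "x \<in> S" "0 < q x y"
  shows "x \<in> L (Suc n)" "\<mu> x = 0"
proof -
  show xL: "x \<in> L (Suc n)"
    using x y q_hessenberg[of x y] by (force simp: levels_upto_iff)
  have terms: "0 \<le> \<mu> z * q z y" if "z \<in> L (Suc n)" for z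
    using that nonneg[OF that] \<open>\<mu> y = 0\<close> y q_nonneg[of z y]
    by (cases "z = y") (auto simp: levels_upto_iff)
  then have "(\<Sum>x\<in>L (Suc n). \<mu> x * q x y) = 0"
    using le by (meson antisym sum_nonneg)
  then have "\<mu> x * q x y = 0"
    using terms xL by (simp add: sum_nonneg_eq_0_iff)
  then show "\<mu> x = 0" using x by simp
qed

section \<open>A minimum principle for the truncated generator\<close>

text \<open>
  Where \<open>x / \<pi>\<close> attains a negative minimum \<open>- c\<close>, the measure \<open>x + c \<pi>\<close> vanishes; its zeros
  propagate backwards along transitions and would fill the whole state space, but
  \<open>x + c \<pi> = c \<pi> > 0\<close> above level \<open>n\<close>.
\<close>

lemma minimum_principle:
  assumes sub: "\<And>y. y \<in> L n \<Longrightarrow> (\<Sum>a\<in>L n. x a * q a y) \<le> 0" and "b \<in> L n"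
  shows "0 \<le> x b"
proof (rule ccontr)
  assume "\<not> 0 \<le> x b"
  define r where "r a = x a / \<pi> a" for a
  define c where "c = - Min (r ` L n)"
  have posL: "0 < \<pi> a" if "a \<in> L m" for a m
    using pi_pos that by (simp add: levels_upto_iff)
  have "r b < 0" using \<open>\<not> 0 \<le> x b\<close> posL[OF \<open>b \<in> L n\<close>] by (simp add: r_def divide_neg_pos)
  moreover have le: "- c \<le> r a" if "a \<in> L n" for a
    using that by (simp add: c_def)
  ultimately have "0 < c" using le[OF \<open>b \<in> L n\<close>] by linarith
  define z where "z a = c * \<pi> a + (if a \<in> L n then x a else 0)" for a
  have z_nonneg: "0 \<le> z a" if "a \<in> S" for a
    using le[of a] pi_pos[OF that] \<open>0 < c\<close> by (auto simp: z_def r_def field_simps)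
  have z_sum: "(\<Sum>a\<in>L (Suc n). z a * q a y) \<le> 0" if "y \<in> L n" for y
  proof -
    have "(\<Sum>a\<in>L (Suc n). \<pi> a * q a y) = 0"
      using sum_column_truncate[of y "Suc n" \<pi>] balanced_pi[of y] that
      by (simp add: levels_upto_iff balanced_def)
    moreover have "(\<Sum>a\<in>L (Suc n). (if a \<in> L n then x a else 0) * q a y) = (\<Sum>a\<in>L n. x a * q a y)"
      using levels_upto_mono[of n "Suc n" M] by (intro sum.mono_neutral_cong_right) auto
    ultimately show ?thesis
      using sub[OF that]
      by (simp add: z_def distrib_right sum.distrib mult.assoc flip: sum_distrib_left)
  qed
  define Z where "Z = {a \<in> L n. z a = 0}"
  have "- c \<in> r ` L n" unfolding c_def minus_minus using \<open>b \<in> L n\<close> by (intro Min_in) auto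
  then obtain s where s: "s \<in> L n" "r s = - c" by auto
  then have "z s = 0" using posL[OF s(1)] by (simp add: z_def r_def field_simps)
  have "Z = S"
  proof (rule backward_closed_imp_all)
    show "s \<in> Z" using s \<open>z s = 0\<close> by (simp add: Z_def)
    show "Z \<subseteq> S" using levels_upto_subset by (auto simp: Z_def)
    fix a y assume *: "y \<in> Z" "a \<in> S" "0 < q a y"
    then have "z a = 0"
      using z_nonneg z_sum
      by (intro zero_propagates_backward(2)[of y n z a]) (auto simp: Z_def levels_upto_iff)
    moreover have "z a \<noteq> 0" if "a \<notin> L n"
      using that \<open>0 < c\<close> pi_pos[OF \<open>a \<in> S\<close>] by (simp add: z_def)
    ultimately show "a \<in> Z" by (auto simp: Z_def)
  qed
  moreover have "(Suc n, 0) \<in> S" using M_pos[of "Suc n"] by (simp add: state_space_def)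
  moreover have "(Suc n, 0) \<notin> Z" by (simp add: Z_def levels_upto_iff)
  ultimately show False by blast
qed

text \<open>Injectivity of the truncated generator on row vectors: the minimum principle applies to
  both \<open>x\<close> and \<open>- x\<close>.\<close>

corollary kernel_trivial:
  assumes "\<And>y. y \<in> L n \<Longrightarrow> (\<Sum>a\<in>L n. x a * q a y) = 0" and "b \<in> L n"
  shows "x b = 0"
  using minimum_principle[of n x b] minimum_principle[of n "\<lambda>a. - x a" b] assms
  by (simp add: sum_negf)

section \<open>Uniqueness of the invariant measure\<close>

text \<open>\<open>taboo n y\<close> is the probability of going from \<open>(0, 0)\<close> to \<open>y\<close> in \<open>n + 1\<close> steps
  without visiting \<open>(0, 0)\<close> in between.\<close>

primrec taboo :: "nat \<Rightarrow> nat \<times> nat \<Rightarrow> real" where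
  "taboo 0 y = P (0, 0) y"
| "taboo (Suc n) y = (\<Sum>x\<in>L (Suc (fst y)) - {(0, 0)}. taboo n x * P x y)"

lemma origin_in_S: "(0, 0) \<in> S"
  using M_pos[of 0] by (simp add: state_space_def)

lemma taboo_nonneg: "y \<in> S \<Longrightarrow> 0 \<le> taboo n y"
  by (induction n arbitrary: y)
    (auto intro!: sum_nonneg mult_nonneg_nonneg embedded_chain_nonneg origin_in_S
      simp: levels_upto_iff)

text \<open>Level 0 cannot be reached from level \<open>k\<close> in fewer than \<open>k\<close>
  steps. This turns the infinite sums in \<open>first_visit_prob\<close> into finite ones.\<close>

lemma first_visit_prob_eq_0:
  "z \<in> S \<Longrightarrow> Suc n < fst z \<Longrightarrow> first_visit_prob S P n z (0, 0) = 0"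
proof (induction n arbitrary: z)
  case 0
  then show ?case using embedded_chain_hessenberg[of z "(0, 0)"] origin_in_S by simp
next
  case (Suc n)
  have "P z w * first_visit_prob S P n w (0, 0) = 0" if "w \<in> S - {(0, 0)}" for w
    using that Suc embedded_chain_hessenberg[of z w] by (cases "Suc n < fst w") auto
  then show ?case unfolding first_visit_prob.simps by (rule infsum_0)
qed

lemma first_visit_prob_Suc_finite:
  "first_visit_prob S P (Suc n) z (0, 0) =
     (\<Sum>w\<in>L (Suc n) - {(0, 0)}. P z w * first_visit_prob S P n w (0, 0))"
proof -
  have "first_visit_prob S P (Suc n) z (0, 0) =
      (\<Sum>\<^sub>\<infinity>w\<in>L (Suc n) - {(0, 0)}. P z w * first_visit_prob S P n w (0, 0))"
    unfolding first_visit_prob.simps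
    by (rule infsum_cong_neutral) (auto simp: levels_upto_iff first_visit_prob_eq_0)
  then show ?thesis by simp
qed

text \<open>A first return to \<open>(0, 0)\<close> in \<open>m + n + 2\<close> steps is split at
  its state after \<open>m + 1\<close> steps. The induction moves one step at a time from the second
  factor to the first.\<close>

lemma taboo_first_visit:
  "(\<Sum>z\<in>L (Suc n) - {(0, 0)}. taboo m z * first_visit_prob S P n z (0, 0)) =
     taboo (Suc (m + n)) (0, 0)"
proof (induction n arbitrary: m)
  case 0
  then show ?case by simp
next
  case (Suc n)
  let ?f = "\<lambda>w. first_visit_prob S P n w (0, 0)"
  have "(\<Sum>z\<in>L (Suc (Suc n)) - {(0, 0)}. taboo m z * first_visit_prob S P (Suc n) z (0, 0)) =
      (\<Sum>z\<in>L (Suc (Suc n)) - {(0, 0)}. \<Sum>w\<in>L (Suc n) - {(0, 0)}. taboo m z * (P z w * ?f w))"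
    by (simp only: first_visit_prob_Suc_finite sum_distrib_left)
  also have "\<dots> = (\<Sum>w\<in>L (Suc n) - {(0, 0)}. \<Sum>z\<in>L (Suc (Suc n)) - {(0, 0)}. taboo m z * (P z w * ?f w))"
    by (rule sum.swap)
  also have "\<dots> = (\<Sum>w\<in>L (Suc n) - {(0, 0)}. taboo (Suc m) w * ?f w)"
  proof (rule sum.cong[OF refl])
    fix w assume w: "w \<in> L (Suc n) - {(0, 0)}"
    \<comment> \<open>The index set may be enlarged because \<open>w\<close> has level at most
      \<open>Suc n\<close> and \<open>P z w\<close> vanishes for \<open>z\<close> above level
      \<open>Suc (fst w)\<close>.\<close>
    have "taboo (Suc m) w = (\<Sum>z\<in>L (Suc (Suc n)) - {(0, 0)}. taboo m z * P z w)"
      using w embedded_chain_hessenberg[of _ w]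
      by (simp, intro sum.mono_neutral_left) (force simp: levels_upto_iff not_le)+
    then show "(\<Sum>z\<in>L (Suc (Suc n)) - {(0, 0)}. taboo m z * (P z w * ?f w)) =
        taboo (Suc m) w * ?f w"
      by (simp add: sum_distrib_right mult.assoc)
  qed
  also have "\<dots> = taboo (Suc (m + Suc n)) (0, 0)"
    using Suc.IH[of "Suc m"] by simp
  finally show ?case .
qed

text \<open>\<open>taboo\<close> splits off the last step and \<open>first_visit_prob\<close> the
  first; the case \<open>m = 0\<close> of the path splitting reconciles them, so that recurrence can
  be applied to \<open>taboo\<close>.\<close>

lemma taboo_origin: "taboo n (0, 0) = first_visit_prob S P n (0, 0) (0, 0)"
proof (cases n)
  case (Suc k)
  then show ?thesis
    using taboo_first_visit[where n = k and m = 0] by (simp only: first_visit_prob_Suc_finite taboo.simps add_0)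
qed simp

lemma taboo_origin_sums: "(\<lambda>n. taboo n (0, 0)) sums 1"
  using ergodic origin_in_S by (simp add: taboo_origin ergodic_Q_def recurrent_chain_def)

text \<open>Passage from \<open>q\<close> to \<open>P\<close>: weighting by the jump rates
  \<open>- q x x\<close> turns balanced measures of \<open>q\<close> into invariant measures of
  \<open>P\<close>. The subtracted term is the diagonal, which \<open>P\<close> lacks.\<close>

lemma sum_embedded_chain:
  assumes "y \<in> S"
  shows "(\<Sum>x\<in>L (Suc (fst y)). \<mu> x * q x y) =
    (\<Sum>x\<in>L (Suc (fst y)). (\<mu> x * - q x x) * P x y) - \<mu> y * - q y y"
proof -
  have "(\<mu> x * - q x x) * P x y = \<mu> x * q x y - (if x = y then \<mu> y * q y y else 0)"
    if "x \<in> L (Suc (fst y))" for x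
    using that q_neg[of x] by (auto simp: levels_upto_iff embedded_chain_eq)
  then have "(\<Sum>x\<in>L (Suc (fst y)). (\<mu> x * - q x x) * P x y) =
    (\<Sum>x\<in>L (Suc (fst y)). \<mu> x * q x y - (if x = y then \<mu> y * q y y else 0))"
    by (rule sum.cong[OF refl])
  then show ?thesis
    using assms by (simp add: sum_subtractf levels_upto_iff)
qed

text \<open>Iterate \<open>m = m P\<close>, keeping the contribution of \<open>(0, 0)\<close> apart
  in each step: it yields the direct jump \<open>P (0, 0) y\<close>, and the other states are
  bounded by the induction hypothesis.\<close>

lemma taboo_le:
  assumes nonneg: "\<And>x. x \<in> S \<Longrightarrow> 0 \<le> m x"
    and inv: "\<And>y. y \<in> S \<Longrightarrow> (\<Sum>x\<in>L (Suc (fst y)). m x * P x y) = m y"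
    and "y \<in> S"
  shows "m (0, 0) * (\<Sum>n<N. taboo n y) \<le> m y"
  using \<open>y \<in> S\<close>
proof (induction N arbitrary: y)
  case 0
  then show ?case using nonneg by simp
next
  case (Suc N)
  let ?B = "L (Suc (fst y)) - {(0, 0)}"
  have "m (0, 0) * (\<Sum>n<Suc N. taboo n y) =
      m (0, 0) * P (0, 0) y + m (0, 0) * (\<Sum>n<N. \<Sum>x\<in>?B. taboo n x * P x y)"
    by (simp add: sum.lessThan_Suc_shift distrib_left del: sum.lessThan_Suc)
  also have "m (0, 0) * (\<Sum>n<N. \<Sum>x\<in>?B. taboo n x * P x y) =
      (\<Sum>x\<in>?B. m (0, 0) * (\<Sum>n<N. taboo n x) * P x y)"
    by (subst sum.swap) (simp add: sum_distrib_left sum_distrib_right mult.assoc)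
  also have "\<dots> \<le> (\<Sum>x\<in>?B. m x * P x y)"
    using Suc by (intro sum_mono mult_right_mono)
      (auto simp: levels_upto_iff embedded_chain_nonneg)
  also have "m (0, 0) * P (0, 0) y + (\<Sum>x\<in>?B. m x * P x y) =
      (\<Sum>x\<in>L (Suc (fst y)). m x * P x y)"
    using origin_in_S by (subst sum.remove[of _ "(0, 0)"]) (auto simp: levels_upto_iff)
  also have "\<dots> = m y" using inv Suc.prems .
  finally show ?case by simp
qed

text \<open>The expected number of visits to \<open>y\<close> after time 0, up to and including the
  first return to \<open>(0, 0)\<close>.\<close>

definition excursion :: "nat \<times> nat \<Rightarrow> real" where
  "excursion y = (\<Sum>n. taboo n y)"

abbreviation jump_measure :: "(nat \<times> nat \<Rightarrow> real) \<Rightarrow> nat \<times> nat \<Rightarrow> real" where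
  "jump_measure \<mu> x \<equiv> \<mu> x * - q x x"

lemma jump_measure_invariant:
  "y \<in> S \<Longrightarrow> balanced \<mu> y \<Longrightarrow>
    (\<Sum>x\<in>L (Suc (fst y)). jump_measure \<mu> x * P x y) = jump_measure \<mu> y"
  using sum_embedded_chain[of y \<mu>] by (simp add: balanced_def)

lemma taboo_le_jump_measure:
  assumes "\<And>x. x \<in> S \<Longrightarrow> 0 \<le> \<mu> x" "\<And>y. y \<in> S \<Longrightarrow> balanced \<mu> y" "y \<in> S"
  shows "jump_measure \<mu> (0, 0) * (\<Sum>n<N. taboo n y) \<le> jump_measure \<mu> y"
proof (rule taboo_le)
  show "0 \<le> jump_measure \<mu> x" if "x \<in> S" for x
    using assms(1)[OF that] q_neg[OF that] by (simp add: mult_nonneg_nonpos)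
qed (use assms jump_measure_invariant in auto)

lemma pi_nonneg: "x \<in> S \<Longrightarrow> 0 \<le> \<pi> x"
  using pi_pos by (simp add: less_imp_le)

lemma jump_measure_pi_pos: "x \<in> S \<Longrightarrow> 0 < jump_measure \<pi> x"
  using pi_pos[of x] q_neg[of x] by (simp add: mult_pos_neg)

text \<open>The jump measure of \<pi> itself bounds the partial sums.\<close>

lemma taboo_summable:
  assumes "y \<in> S" shows "summable (\<lambda>n. taboo n y)"
proof (rule summableI_nonneg_bounded)
  show "0 \<le> taboo n y" for n using taboo_nonneg[OF assms] .
  show "(\<Sum>i<n. taboo i y) \<le> jump_measure \<pi> y / jump_measure \<pi> (0, 0)" for n
    using taboo_le_jump_measure[OF pi_nonneg balanced_pi assms, of n]
      jump_measure_pi_pos[OF origin_in_S]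
    by (simp only: pos_le_divide_eq mult.commute)
qed

lemma excursion_origin: "excursion (0, 0) = 1"
  using taboo_origin_sums by (simp add: excursion_def sums_iff)

text \<open>Removing the term for one step leaves the sum over states other than
  \<open>(0, 0)\<close>. The removed \<open>P (0, 0) y\<close> is exactly the missing summand
  because \<open>excursion (0, 0) = 1\<close>, which is recurrence.\<close>

lemma excursion_invariant:
  assumes "y \<in> S"
  shows "(\<Sum>x\<in>L (Suc (fst y)). excursion x * P x y) = excursion y"
proof -
  let ?B = "L (Suc (fst y)) - {(0, 0)}"
  have "excursion y - P (0, 0) y = (\<Sum>n. taboo (Suc n) y)"
    using suminf_split_head[OF taboo_summable[OF assms]] by (simp add: excursion_def)
  also have "\<dots> = (\<Sum>x\<in>?B. \<Sum>n. taboo n x * P x y)"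
    by (simp, intro suminf_sum summable_mult2 taboo_summable) (auto simp: levels_upto_iff)
  also have "\<dots> = (\<Sum>x\<in>?B. excursion x * P x y)"
    unfolding excursion_def
    by (intro sum.cong refl suminf_mult2[symmetric] taboo_summable) (auto simp: levels_upto_iff)
  finally show ?thesis
    using origin_in_S
    by (subst sum.remove[of _ "(0, 0)"]) (auto simp: levels_upto_iff excursion_origin)
qed

text \<open>
  An invariant measure of the embedded chain dominates its value at \<open>(0, 0)\<close> times the expected
  number of visits during an excursion from \<open>(0, 0)\<close>. By recurrence the latter is invariant, so
  the difference is a nonnegative invariant measure vanishing at \<open>(0, 0)\<close>, hence everywhere.
\<close>

lemma jump_measure_eq_excursion:
  assumes nonneg: "\<And>x. x \<in> S \<Longrightarrow> 0 \<le> \<mu> x" and bal: "\<And>y. y \<in> S \<Longrightarrow> balanced \<mu> y"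
    and "x \<in> S"
  shows "jump_measure \<mu> x = jump_measure \<mu> (0, 0) * excursion x"
proof -
  define a where "a = jump_measure \<mu> (0, 0)"
  \<comment> \<open>Dividing the difference by the jump rate gives a measure for \<open>q\<close>
    rather than \<open>P\<close>, to which the backward propagation of zeros applies.\<close>
  define \<sigma> where "\<sigma> y = (jump_measure \<mu> y - a * excursion y) / (- q y y)" for y
  have jump_\<sigma>: "jump_measure \<sigma> y = jump_measure \<mu> y - a * excursion y" if "y \<in> S" for y
    using q_neg[OF that] by (simp add: \<sigma>_def)
  have \<sigma>_nonneg: "0 \<le> \<sigma> y" if "y \<in> S" for y
  proof -
    have "(\<lambda>N. a * (\<Sum>n<N. taboo n y)) \<longlonglongrightarrow> a * excursion y"
      unfolding excursion_def
      by (intro tendsto_mult tendsto_const summable_LIMSEQ taboo_summable that)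
    then have "a * excursion y \<le> jump_measure \<mu> y"
      using taboo_le_jump_measure[OF nonneg bal that] unfolding a_def
      by (intro LIMSEQ_le_const2) auto
    then show ?thesis using q_neg[OF that] unfolding \<sigma>_def by (intro divide_nonneg_pos) auto
  qed
  have \<sigma>_balanced: "(\<Sum>x\<in>L (Suc (fst y)). \<sigma> x * q x y) = 0" if "y \<in> S" for y
  proof -
    have "(\<Sum>x\<in>L (Suc (fst y)). jump_measure \<sigma> x * P x y) =
        (\<Sum>x\<in>L (Suc (fst y)). jump_measure \<mu> x * P x y - a * (excursion x * P x y))"
      by (intro sum.cong refl) (simp only: jump_\<sigma> levels_upto_iff left_diff_distrib mult.assoc)
    also have "\<dots> = jump_measure \<mu> y - a * excursion y"
      using jump_measure_invariant[OF that bal[OF that]] excursion_invariant[OF that]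
      by (simp only: sum_subtractf flip: sum_distrib_left)
    also have "\<dots> = jump_measure \<sigma> y" using jump_\<sigma>[OF that] by simp
    finally show ?thesis using sum_embedded_chain[OF that, of \<sigma>] by simp
  qed
  have "{x \<in> S. \<sigma> x = 0} = S"
  proof (rule backward_closed_imp_all)
    show "(0, 0) \<in> {x \<in> S. \<sigma> x = 0}"
      using origin_in_S by (simp add: \<sigma>_def a_def excursion_origin)
    fix x y assume *: "y \<in> {x \<in> S. \<sigma> x = 0}" "x \<in> S" "0 < q x y"
    then have "\<sigma> x = 0"
      using \<sigma>_nonneg \<sigma>_balanced[of y]
      by (intro zero_propagates_backward(2)[of y "fst y" \<sigma> x]) (auto simp: levels_upto_iff)
    with * show "x \<in> {x \<in> S. \<sigma> x = 0}" by simp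
  qed auto
  then have "\<sigma> x = 0" using \<open>x \<in> S\<close> by blast
  then show ?thesis using jump_\<sigma>[OF \<open>x \<in> S\<close>] by (simp add: a_def)
qed

text \<open>The jump measures of \<open>\<mu>\<close> and \<open>\<pi>\<close> are both multiples of
  \<open>excursion\<close>; cancelling the rate at \<open>x\<close> leaves proportionality.\<close>

lemma invariant_measure_unique:
  assumes "\<And>x. x \<in> S \<Longrightarrow> 0 \<le> \<mu> x" "\<And>y. y \<in> S \<Longrightarrow> balanced \<mu> y"
  obtains c where "\<And>x. x \<in> S \<Longrightarrow> \<mu> x = c * \<pi> x"
proof
  fix x assume x: "x \<in> S"
  have "jump_measure \<mu> x * jump_measure \<pi> (0, 0) = jump_measure \<mu> (0, 0) * jump_measure \<pi> x"
    using jump_measure_eq_excursion[OF assms x] jump_measure_eq_excursion[OF pi_nonneg balanced_pi x]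
    by (simp only: mult_ac)
  then have "\<mu> x * jump_measure \<pi> (0, 0) = jump_measure \<mu> (0, 0) * \<pi> x"
    using q_neg[OF x] by (simp add: mult.assoc mult.left_commute[of _ "q x x"])
  then show "\<mu> x = (jump_measure \<mu> (0, 0) / jump_measure \<pi> (0, 0)) * \<pi> x"
    using jump_measure_pi_pos[OF origin_in_S]
    by (simp only: times_divide_eq_left nonzero_eq_divide_eq less_imp_neq[THEN not_sym] not_False_eq_True)
qed

end

section \<open>Block elimination and the matrices \<open>U\<^sub>n\<^sup>*\<close>\<close>

lemma down_prod_carrier:
  assumes "\<And>m. m < n \<Longrightarrow> F m \<in> carrier_mat (M (Suc m)) (M m)" "l \<le> n"
  shows "down_prod M F n l \<in> carrier_mat (M n) (M l)"
  using assms(2,1)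
proof (induction n rule: dec_induct)
  case (step k)
  then have "F k \<in> carrier_mat (M (Suc k)) (M k)" "down_prod M F k l \<in> carrier_mat (M k) (M l)"
    by auto
  from mult_carrier_mat[OF this] show ?case using step by (simp add: down_prod_Suc)
qed (simp add: down_prod_refl)

lemma down_prod_mult:
  assumes "\<And>m. m < n \<Longrightarrow> F m \<in> carrier_mat (M (Suc m)) (M m)" "l \<le> m" "m \<le> n"
  shows "down_prod M F n m * down_prod M F m l = down_prod M F n l"
  using assms(3,1)
proof (induction n rule: dec_induct)
  case base
  then show ?case
    using down_prod_carrier[of m F M l] assms(2) by (simp add: down_prod_refl)
next
  case (step k)
  have "F k \<in> carrier_mat (M (Suc k)) (M k)" "down_prod M F k m \<in> carrier_mat (M k) (M m)"
    "down_prod M F m l \<in> carrier_mat (M m) (M l)"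
    using step.prems step.hyps assms(2) by (auto intro!: down_prod_carrier)
  from assoc_mult_mat[OF this] show ?case
    using step assms(2) by (simp add: down_prod_Suc)
qed

context hessenberg_chain
begin

abbreviation "Qb \<equiv> Q_block M q"
abbreviation "U \<equiv> U_star M q"
abbreviation "D \<equiv> down_prod M (U_mat M q)"

text \<open>Minus the generator of the chain that is observed on level \<open>n\<close> only and killed when it
  leaves the levels up to \<open>n\<close>; it is a Schur complement of the truncated generator.\<close>

definition censored :: "nat \<Rightarrow> real mat" where
  "censored n = - Qb n n - mat (M n) (M n) (\<lambda>ij. \<Sum>l<n. (D n l * Qb l n) $$ ij)"

lemma U_star_eq: "U n = the (mat_inverse (censored n))"
proof -
  have "(\<lambda>m. Qb (m + 1) m * U m) = U_mat M q" by (simp add: fun_eq_iff U_mat_def)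
  then show ?thesis unfolding censored_def by (subst U_star.simps) simp
qed

lemma Q_block_carrier [simp]: "Qb k l \<in> carrier_mat (M k) (M l)"
  by (simp add: Q_block_def)

lemma Q_block_dim [simp]: "dim_row (Qb k l) = M k" "dim_col (Qb k l) = M l"
  by (simp_all add: Q_block_def)

lemma censored_dim [simp]: "dim_row (censored n) = M n" "dim_col (censored n) = M n"
  by (simp_all add: censored_def)

lemma censored_carrier [simp]: "censored n \<in> carrier_mat (M n) (M n)"
  by (intro carrier_matI) simp_all

lemma Q_block_index [simp]: "i < M k \<Longrightarrow> j < M l \<Longrightarrow> Qb k l $$ (i, j) = q (k, i) (l, j)"
  by (simp add: Q_block_def)

text \<open>Induction hypothesis for the existence of the inverses: \<open>U_star\<close> is defined
  through \<open>the (mat_inverse ...)\<close> and says nothing until invertibility is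
  proved.\<close>

definition invertible_below :: "nat \<Rightarrow> bool" where
  "invertible_below n \<longleftrightarrow> (\<forall>m<n. U m \<in> carrier_mat (M m) (M m) \<and> U m * censored m = 1\<^sub>m (M m))"

lemma U_mat_carrier:
  assumes "invertible_below n" "m < n"
  shows "U_mat M q m \<in> carrier_mat (M (Suc m)) (M m)"
proof -
  have "U m \<in> carrier_mat (M m) (M m)" using assms by (simp add: invertible_below_def)
  then show ?thesis by (simp add: U_mat_def mult_carrier_mat[OF Q_block_carrier])
qed

text \<open>Block elimination: \<open>V\<close>, given on level \<open>n\<close>, is extended by \<open>V * D n l\<close> to the levels
  \<open>l < n\<close>.\<close>

lemma row_solution_censored:
  assumes inv: "invertible_below n" and V: "V \<in> carrier_mat r (M n)"
    and "m \<le> n" "i < r" "j < M m"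
  shows "(\<Sum>l\<le>m. \<Sum>k<M l. (V * D n l) $$ (i, k) * q (l, k) (m, j)) =
    - (V * D n m * censored m) $$ (i, j)"
proof -
  have D: "D n' l \<in> carrier_mat (M n') (M l)" if "l \<le> n'" "n' \<le> n" for n' l
    using that inv by (intro down_prod_carrier U_mat_carrier[of n]) auto
  define X where "X l = V * D n l" for l
  have X: "X l \<in> carrier_mat r (M l)" if "l \<le> n" for l
    unfolding X_def using V D[OF that] by simp
  have X_mult: "X m * D m l = X l" if "l \<le> m" for l
    unfolding X_def assoc_mult_mat[OF V D[OF \<open>m \<le> n\<close> order_refl] D[OF that \<open>m \<le> n\<close>]]
    using down_prod_mult[where M = M and F = "U_mat M q" and n = n, OF U_mat_carrier[OF inv] that \<open>m \<le> n\<close>] by simp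
  have entry: "(A * B) $$ (i, j) = (\<Sum>k<b. A $$ (i, k) * B $$ (k, j))"
    if "A \<in> carrier_mat r b" "B \<in> carrier_mat b (M m)" for A B b
    using that \<open>i < r\<close> \<open>j < M m\<close> by (auto simp: scalar_prod_def lessThan_atLeast0)
  \<comment> \<open>Each lower level is factored through level \<open>m\<close>, which produces the
    correction terms in \<open>censored m\<close>.\<close>
  have *: "(\<Sum>k<M l. X l $$ (i, k) * q (l, k) (m, j)) =
      (\<Sum>k<M m. X m $$ (i, k) * (D m l * Qb l m) $$ (k, j))" if "l \<le> m" for l
  proof -
    have "(\<Sum>k<M l. X l $$ (i, k) * q (l, k) (m, j)) = (X l * Qb l m) $$ (i, j)"
      using that \<open>m \<le> n\<close> \<open>j < M m\<close> by (subst entry[OF X]) auto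
    also have "X l * Qb l m = X m * (D m l * Qb l m)"
      using assoc_mult_mat[OF X[OF \<open>m \<le> n\<close>] D[OF that \<open>m \<le> n\<close>] Q_block_carrier]
      by (simp add: X_mult[OF that])
    also have "\<dots> $$ (i, j) = (\<Sum>k<M m. X m $$ (i, k) * (D m l * Qb l m) $$ (k, j))"
      using X[OF \<open>m \<le> n\<close>] mult_carrier_mat[OF D[OF that \<open>m \<le> n\<close>] Q_block_carrier] by (rule entry)
    finally show ?thesis .
  qed
  have "(X m * censored m) $$ (i, j) = (\<Sum>k<M m. X m $$ (i, k) * censored m $$ (k, j))"
    using X[OF \<open>m \<le> n\<close>] by (intro entry) auto
  also have "\<dots> = (\<Sum>k<M m. - (X m $$ (i, k) * q (m, k) (m, j))
      - (\<Sum>l<m. X m $$ (i, k) * (D m l * Qb l m) $$ (k, j)))"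
    using \<open>j < M m\<close>
    by (intro sum.cong) (auto simp: censored_def right_diff_distrib sum_distrib_left Q_block_def)
  also have "\<dots> = - (\<Sum>k<M m. X m $$ (i, k) * q (m, k) (m, j))
      - (\<Sum>l<m. \<Sum>k<M m. X m $$ (i, k) * (D m l * Qb l m) $$ (k, j))"
    by (simp add: sum_subtractf sum_negf sum.swap[of _ "{..<m}"])
  also have "(\<Sum>l<m. \<Sum>k<M m. X m $$ (i, k) * (D m l * Qb l m) $$ (k, j)) =
      (\<Sum>l<m. \<Sum>k<M l. X l $$ (i, k) * q (l, k) (m, j))"
    by (intro sum.cong[OF refl] *[symmetric]) auto
  finally show ?thesis
    by (simp add: X_def lessThan_Suc_atMost[symmetric])
qed

text \<open>For a column on level \<open>m < n\<close>, the levels up to \<open>m\<close> contribute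
  \<open>- (X m * censored m)\<close>. Since \<open>U m\<close> is a left inverse of
  \<open>censored m\<close>, this equals \<open>- (X (Suc m) * Qb (Suc m) m)\<close> and cancels the
  contribution of level \<open>m + 1\<close>.\<close>

lemma row_solution:
  assumes inv: "invertible_below n" and V: "V \<in> carrier_mat r (M n)" and "i < r" and y: "y \<in> L n"
  shows "(\<Sum>x\<in>L n. (V * D n (fst x)) $$ (i, snd x) * q x y) =
    (if fst y = n then - (V * censored n) $$ (i, snd y) else 0)"
proof -
  obtain m j where y_eq: "y = (m, j)" by (cases y)
  with y have "m \<le> n" "j < M m" "y \<in> S" by (auto simp: levels_upto_def state_space_def)
  show ?thesis
  proof (cases "m = n")
    case True
    then show ?thesis
      using row_solution_censored[OF inv V _ \<open>i < r\<close>, of n j] \<open>j < M m\<close> V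
      by (simp add: sum_levels_upto y_eq down_prod_refl)
  next
    case False
    then have "m < n" using \<open>m \<le> n\<close> by simp
    have D: "D n l \<in> carrier_mat (M n) (M l)" if "l \<le> n" for l
      using that inv by (intro down_prod_carrier U_mat_carrier[of n]) auto
    define X where "X l = V * D n l" for l
    have X: "X l \<in> carrier_mat r (M l)" if "l \<le> n" for l
      unfolding X_def using V D[OF that] by simp
    have U: "U m \<in> carrier_mat (M m) (M m)" "U m * censored m = 1\<^sub>m (M m)"
      using inv \<open>m < n\<close> by (auto simp: invertible_below_def)
    have "D n m = D n (Suc m) * D (Suc m) m"
      using \<open>m < n\<close> inv by (intro down_prod_mult[symmetric] U_mat_carrier) auto
    also have "D (Suc m) m = U_mat M q m"
      using U_mat_carrier[OF inv \<open>m < n\<close>] by (simp add: down_prod_Suc down_prod_refl)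
    also have "\<dots> = Qb (Suc m) m * U m" by (simp add: U_mat_def)
    finally have D_step: "D n m = D n (Suc m) * (Qb (Suc m) m * U m)" .
    have X1: "X (Suc m) \<in> carrier_mat r (M (Suc m))" using X \<open>m < n\<close> by simp
    have QU: "Qb (Suc m) m * U m \<in> carrier_mat (M (Suc m)) (M m)"
      using Q_block_carrier U(1) by (rule mult_carrier_mat)
    have "X m = X (Suc m) * (Qb (Suc m) m * U m)"
      unfolding X_def D_step
      using assoc_mult_mat[OF V D QU] \<open>m < n\<close> by simp
    then have "X m * censored m = X (Suc m) * (Qb (Suc m) m * U m * censored m)"
      by (simp add: assoc_mult_mat[OF X1 QU censored_carrier])
    also have "Qb (Suc m) m * U m * censored m = Qb (Suc m) m"
      by (simp add: assoc_mult_mat[OF Q_block_carrier U(1) censored_carrier] U(2)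
          right_mult_one_mat[OF Q_block_carrier])
    finally have X_censored: "X m * censored m = X (Suc m) * Qb (Suc m) m" .
    have "(\<Sum>x\<in>L n. X (fst x) $$ (i, snd x) * q x y) =
        (\<Sum>x\<in>L (Suc m). X (fst x) $$ (i, snd x) * q x y)"
      using sum_column_truncate[OF \<open>y \<in> S\<close>, of n] \<open>m < n\<close> by (simp add: y_eq)
    also have "\<dots> = (\<Sum>l\<le>m. \<Sum>k<M l. X l $$ (i, k) * q (l, k) (m, j)) +
        (\<Sum>k<M (Suc m). X (Suc m) $$ (i, k) * q (Suc m, k) (m, j))"
      by (simp add: sum_levels_upto y_eq)
    also have "(\<Sum>l\<le>m. \<Sum>k<M l. X l $$ (i, k) * q (l, k) (m, j)) = - (X m * censored m) $$ (i, j)"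
      unfolding X_def using row_solution_censored[OF inv V \<open>m \<le> n\<close> \<open>i < r\<close> \<open>j < M m\<close>] .
    also have "(\<Sum>k<M (Suc m). X (Suc m) $$ (i, k) * q (Suc m, k) (m, j)) =
        (X (Suc m) * Qb (Suc m) m) $$ (i, j)"
      using X1 \<open>i < r\<close> \<open>j < M m\<close> Q_block_carrier[of "Suc m" m]
      by (auto simp: scalar_prod_def lessThan_atLeast0 Q_block_def)
    finally show ?thesis using False by (simp add: X_censored) (simp add: X_def y_eq)
  qed
qed

text \<open>A left null vector of \<open>censored n\<close> would extend by block elimination to a
  null vector of the truncated generator, which \<open>kernel_trivial\<close> excludes.\<close>

lemma invertible_step:
  assumes inv: "invertible_below n"
  shows "U n \<in> carrier_mat (M n) (M n) \<and> U n * censored n = 1\<^sub>m (M n)"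
proof -
  have "det (censored n) \<noteq> 0"
  proof
    assume "det (censored n) = 0"
    then have "det (transpose_mat (censored n)) = 0"
      using det_transpose[OF censored_carrier] by simp
    then obtain v where v: "v \<in> carrier_vec (M n)" "v \<noteq> 0\<^sub>v (M n)"
      "transpose_mat (censored n) *\<^sub>v v = 0\<^sub>v (M n)"
      using det_0_iff_vec_prod_zero_field[of "transpose_mat (censored n)" "M n"] by auto
    \<comment> \<open>The null vector as a one-row matrix, the format of
      \<open>row_solution\<close>.\<close>
    define V where "V = mat 1 (M n) (\<lambda>(i, j). v $ j)"
    have V: "V \<in> carrier_mat 1 (M n)" by (simp add: V_def)
    have V_kernel: "(V * censored n) $$ (0, j) = 0" if "j < M n" for j
    proof -
      have "(V * censored n) $$ (0, j) = (transpose_mat (censored n) *\<^sub>v v) $ j"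
        using that v(1) censored_carrier[of n]
        by (auto simp: V_def scalar_prod_def mult.commute intro!: sum.cong)
      then show ?thesis using v(3) that by simp
    qed
    have "v $ j = 0" if "j < M n" for j
    proof -
      have "(V * D n (fst (n, j))) $$ (0, snd (n, j)) = 0"
      proof (rule kernel_trivial[of n "\<lambda>x. (V * D n (fst x)) $$ (0, snd x)"])
        show "(n, j) \<in> L n" using that by (simp add: levels_upto_def)
        fix y assume "y \<in> L n"
        then show "(\<Sum>x\<in>L n. (V * D n (fst x)) $$ (0, snd x) * q x y) = 0"
          using row_solution[OF inv V, of 0 y] V_kernel by (auto simp: levels_upto_def)
      qed
      then show ?thesis using that V by (simp add: down_prod_refl) (simp add: V_def)
    qed
    then show False using v(1,2) by auto
  qed
  then have "censored n \<in> Units (ring_mat TYPE(real) (M n) ())"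
    by (intro det_non_zero_imp_unit) auto
  then obtain B where "mat_inverse (censored n) = Some B"
    using mat_inverse(1)[OF censored_carrier] by fastforce
  with mat_inverse(2)[OF censored_carrier this] show ?thesis by (simp add: U_star_eq)
qed

lemma invertible_below: "invertible_below n"
proof (induction n)
  case (Suc n)
  then show ?case
    using invertible_step[OF Suc] by (auto simp: invertible_below_def less_Suc_eq)
qed (simp add: invertible_below_def)

section \<open>Sojourn times as solutions of truncated balance equations\<close>

lemma U_star_carrier: "U n \<in> carrier_mat (M n) (M n)"
  and U_star_censored: "U n * censored n = 1\<^sub>m (M n)"
  using invertible_step[OF invertible_below] by auto

lemma down_prod_U_carrier: "l \<le> n \<Longrightarrow> D n l \<in> carrier_mat (M n) (M l)"
  using invertible_below by (intro down_prod_carrier U_mat_carrier) auto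

lemma U_star2_carrier: "l \<le> n \<Longrightarrow> U_star2 M q n l \<in> carrier_mat (M n) (M l)"
  unfolding U_star2_def by (rule mult_carrier_mat[OF U_star_carrier down_prod_U_carrier])

text \<open>Expected time spent in \<open>x\<close>, starting from \<open>(n, i)\<close>, before the levels above \<open>n\<close> are reached.\<close>

definition sojourn :: "nat \<Rightarrow> nat \<Rightarrow> nat \<times> nat \<Rightarrow> real" where
  "sojourn n i x = U_star2 M q n (fst x) $$ (i, snd x)"

lemma sojourn_equation:
  assumes "i < M n" "y \<in> L n"
  shows "(\<Sum>x\<in>L n. sojourn n i x * q x y) = (if y = (n, i) then - 1 else 0)"
  using row_solution[OF invertible_below U_star_carrier assms] assms
  by (cases y) (auto simp: sojourn_def U_star2_def U_star_censored levels_upto_def)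

text \<open>The right-hand side of \<open>sojourn_equation\<close> is at most 0, so the minimum
  principle applies.\<close>

lemma sojourn_nonneg:
  assumes "i < M n" "x \<in> L n"
  shows "0 \<le> sojourn n i x"
  using assms by (intro minimum_principle[of n]) (auto simp: sojourn_equation)

definition total_sojourn :: "nat \<Rightarrow> nat \<Rightarrow> real" where
  "total_sojourn n i = (\<Sum>x\<in>L n. sojourn n i x)"

text \<open>A zero total would make the whole row vanish, against the source \<open>- 1\<close> at
  \<open>(n, i)\<close>.\<close>

lemma total_sojourn_pos:
  assumes "i < M n"
  shows "0 < total_sojourn n i"
proof -
  have "total_sojourn n i \<noteq> 0"
  proof
    assume "total_sojourn n i = 0"
    then have "\<forall>x\<in>L n. sojourn n i x = 0"
      using sojourn_nonneg[OF assms] by (simp add: total_sojourn_def sum_nonneg_eq_0_iff)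
    moreover have "(n, i) \<in> L n" using assms by (simp add: levels_upto_def)
    ultimately show False using sojourn_equation[OF assms, of "(n, i)"] by simp
  qed
  then show ?thesis
    using sojourn_nonneg[OF assms] by (simp add: total_sojourn_def order_less_le sum_nonneg)
qed

lemma u_star_on_eq:
  assumes "i < M n" "K \<subseteq> {..n}"
  shows "u_star_on M q K n $ i = (\<Sum>x\<in>{x \<in> L n. fst x \<in> K}. sojourn n i x)"
proof -
  have "u_star_on M q K n $ i = (\<Sum>l\<in>K. \<Sum>k<M l. sojourn n i (l, k))"
    unfolding u_star_on_def using assms
  proof (simp, intro sum.cong refl)
    fix l assume "l \<in> K"
    then have "U_star2 M q n l \<in> carrier_mat (M n) (M l)" using assms by (intro U_star2_carrier) auto
    then show "(U_star2 M q n l *\<^sub>v ones_vec (M l)) $ i = (\<Sum>k<M l. sojourn n i (l, k))"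
      using assms(1) by (auto simp: scalar_prod_def ones_vec_def sojourn_def lessThan_atLeast0)
  qed
  also have "\<dots> = (\<Sum>x\<in>(SIGMA l:K. {..<M l}). sojourn n i x)"
    using assms(2) by (simp add: sum.Sigma finite_subset)
  also have "(SIGMA l:K. {..<M l}) = {x \<in> L n. fst x \<in> K}"
    using assms(2) by (auto simp: levels_upto_def)
  finally show ?thesis .
qed

lemma u_star_eq: "i < M n \<Longrightarrow> u_star M q n $ i = total_sojourn n i"
  unfolding u_star_def total_sojourn_def
  by (subst u_star_on_eq) (auto intro!: sum.cong simp: levels_upto_def)

text \<open>The stationary rate of jumps from level \<open>n + 1\<close> into
  \<open>y\<close>.\<close>

definition inflow :: "nat \<Rightarrow> nat \<times> nat \<Rightarrow> real" where
  "inflow n y = (\<Sum>x\<in>L (Suc n) - L n. \<pi> x * q x y)"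

lemma inflow_nonneg: "y \<in> L n \<Longrightarrow> 0 \<le> inflow n y"
  unfolding inflow_def
  by (intro sum_nonneg mult_nonneg_nonneg less_imp_le[OF pi_pos] q_nonneg)
    (auto simp: levels_upto_iff)

lemma inflow_below: "y \<in> L n \<Longrightarrow> fst y \<noteq> n \<Longrightarrow> inflow n y = 0"
  unfolding inflow_def by (intro sum.neutral) (auto simp: levels_upto_iff q_hessenberg)

text \<open>Only phases in \<open>I_plus\<close> contribute to \<pi>, so a maximum over
  \<open>I_plus\<close> controls the whole mixture.\<close>

lemma inflow_I_plus:
  assumes "i < M n" "inflow n (n, i) \<noteq> 0"
  shows "i \<in> I_plus M q n"
proof -
  have "\<exists>x\<in>L (Suc n) - L n. \<pi> x * q x (n, i) \<noteq> 0"
    using assms(2) unfolding inflow_def by (meson sum.neutral)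
  then obtain k where k: "k < M (Suc n)" "q (Suc n, k) (n, i) \<noteq> 0"
    by (auto simp: levels_upto_def le_Suc_eq)
  have nonneg: "0 \<le> q (Suc n, k') (n, i)" if "k' < M (Suc n)" for k'
    using q_nonneg[of "(Suc n, k')" "(n, i)"] that assms(1) by (simp add: state_space_def)
  have "0 < q (Suc n, k) (n, i)" using k(2) nonneg[OF k(1)] by simp
  then have "0 < (\<Sum>k'<M (Suc n). q (Suc n, k') (n, i))"
    using k(1) nonneg by (intro sum_pos2[of _ k]) auto
  then show ?thesis
    using assms(1)
    by (simp add: I_plus_def row_vec_mult_def ones_vec_def Q_block_def scalar_prod_def lessThan_atLeast0)
qed

text \<open>Both sides solve the same truncated equations: cutting \<pi> at level \<open>n\<close>
  leaves the source \<open>- inflow n y\<close>, which lives on level \<open>n\<close>, and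
  \<open>sojourn n i\<close> has the source \<open>- 1\<close> at \<open>(n, i)\<close>. Injectivity
  gives equality.\<close>

lemma pi_eq_sum_sojourn:
  assumes "x \<in> L n"
  shows "\<pi> x = (\<Sum>i<M n. inflow n (n, i) * sojourn n i x)"
proof -
  have "(\<lambda>x. \<pi> x - (\<Sum>i<M n. inflow n (n, i) * sojourn n i x)) x = 0"
  proof (rule kernel_trivial[OF _ assms])
    fix y assume y: "y \<in> L n"
    have "(\<Sum>a\<in>L (Suc n). \<pi> a * q a y) = 0"
      using sum_column_truncate[of y "Suc n" \<pi>] balanced_pi[of y] y
      by (simp add: levels_upto_iff balanced_def)
    then have "(\<Sum>a\<in>L n. \<pi> a * q a y) = - inflow n y"
      using sum.subset_diff[OF levels_upto_mono, of n "Suc n" M "\<lambda>a. \<pi> a * q a y"]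
      by (simp add: inflow_def)
    moreover have "(\<Sum>a\<in>L n. (\<Sum>i<M n. inflow n (n, i) * sojourn n i a) * q a y) =
        (\<Sum>i<M n. inflow n (n, i) * (\<Sum>a\<in>L n. sojourn n i a * q a y))"
      by (subst sum_distrib_left, subst sum.swap) (simp add: sum_distrib_right mult.assoc)
    moreover have "\<dots> = (\<Sum>i<M n. if (n, i) = y then - inflow n y else 0)"
      using y by (intro sum.cong) (auto simp: sojourn_equation)
    moreover have "\<dots> = - inflow n y"
      using y inflow_below[OF y] by (cases "fst y = n"; cases y) (auto simp: levels_upto_def)
    ultimately show "(\<Sum>a\<in>L n. (\<pi> a - (\<Sum>i<M n. inflow n (n, i) * sojourn n i a)) * q a y) = 0"
      by (simp add: left_diff_distrib sum_subtractf)
  qed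
  then show ?thesis by simp
qed

end

section \<open>Convergence to the stationary distribution\<close>

lemma compact_unit_cube: "compact (UNIV \<rightarrow>\<^sub>E {0..1::real})"
proof -
  have "compactin (product_topology (\<lambda>_. euclidean) UNIV) (UNIV \<rightarrow>\<^sub>E {0..1::real})"
    by (simp add: compactin_PiE)
  then show ?thesis
    by (simp only: euclidean_product_topology compactin_euclidean_iff)
qed

text \<open>Tychonoff in place of a diagonal argument: the product over a countable type is first
  countable, so compactness gives sequential compactness.\<close>

lemma subprobability_convergent_subseq:
  fixes p :: "nat \<Rightarrow> 'a :: countable \<Rightarrow> real"
  assumes "\<And>n x. 0 \<le> p n x" "\<And>n x. p n x \<le> 1"
  obtains \<mu> r where "strict_mono (r :: nat \<Rightarrow> nat)" "\<And>x. (\<lambda>n. p (r n) x) \<longlonglongrightarrow> \<mu> x"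
proof -
  have "p n \<in> UNIV \<rightarrow>\<^sub>E {0..1::real}" for n using assms by auto
  from compact_imp_seq_compact[OF compact_unit_cube, unfolded seq_compact_def, rule_format, of p, OF this]
  obtain \<mu> r where "strict_mono (r :: nat \<Rightarrow> nat)" and lim: "(p \<circ> r) \<longlonglongrightarrow> \<mu>"
    by blast
  have "(\<lambda>n. p (r n) x) \<longlonglongrightarrow> \<mu> x" for x
    using continuous_on_tendsto_compose[OF continuous_on_product_coordinates lim, of x]
    by (simp add: o_def)
  then show ?thesis using that \<open>strict_mono r\<close> by blast
qed

text \<open>A finite \<open>F\<close> carries almost all of \<pi>. By convergence on
  \<open>F\<close>, \<open>p n\<close> has almost all its mass there too, and both tails are
  small.\<close>

lemma scheffe_l1_dist:
  fixes p :: "nat \<Rightarrow> 's \<Rightarrow> real"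
  assumes lim: "\<And>x. x \<in> S \<Longrightarrow> (\<lambda>n. p n x) \<longlonglongrightarrow> \<pi> x"
    and p_nonneg: "\<And>n x. 0 \<le> p n x" and p_sum: "\<And>n F. finite F \<Longrightarrow> sum (p n) F \<le> 1"
    and pi_nonneg: "\<And>x. x \<in> S \<Longrightarrow> 0 \<le> \<pi> x" and pi_sum: "(\<pi> has_sum 1) S"
  shows "(\<lambda>n. l1_dist S (p n) \<pi>) \<longlonglongrightarrow> 0"
proof (rule order_tendstoI)
  fix a :: ennreal assume "0 < a"
  \<comment> \<open>\<open>a\<close> may be infinite; an intermediate \<open>e'\<close> is finite
    and leaves room for a strict inequality.\<close>
  then obtain e' where e': "0 < e'" "e' < a" using dense by blast
  then obtain e where e: "e' = ennreal e" "0 < e"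
    by (cases e') auto
  \<comment> \<open>The budget is \<open>e / 4\<close> for the distance on \<open>F\<close>,
    \<open>e / 4\<close> for the tail of \<pi>, and \<open>e / 2\<close> for the tail of
    \<open>p n\<close>.\<close>
  obtain F where F: "finite F" "F \<subseteq> S" "dist (sum \<pi> F) 1 \<le> e / 4"
    using has_sum_finite_approximation[OF pi_sum, of "e / 4"] \<open>0 < e\<close> by auto
  then have F_sum: "1 - sum \<pi> F \<le> e / 4" unfolding dist_real_def by linarith
  have "(\<lambda>n. \<Sum>x\<in>F. \<bar>p n x - \<pi> x\<bar>) \<longlonglongrightarrow> (\<Sum>x\<in>F. \<bar>\<pi> x - \<pi> x\<bar>)"
    using F by (intro tendsto_intros lim) auto
  then have "\<forall>\<^sub>F n in sequentially. (\<Sum>x\<in>F. \<bar>p n x - \<pi> x\<bar>) < e / 4"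
    using \<open>0 < e\<close> by (intro order_tendstoD(2)) auto
  then show "\<forall>\<^sub>F n in sequentially. l1_dist S (p n) \<pi> < a"
  proof (eventually_elim)
    case (elim n)
    have bound: "(\<Sum>x\<in>A. \<bar>p n x - \<pi> x\<bar>) \<le> e" if A: "finite A" "A \<subseteq> S" for A
    proof -
      have "sum (p n) (A - F) + sum (p n) F \<le> 1"
        using p_sum[of "A \<union> F" n] F A by (simp add: sum.subset_diff[of F "A \<union> F"] Un_Diff)
      moreover have "sum \<pi> (A - F) + sum \<pi> F \<le> 1"
        using finite_sum_le_has_sum[OF pi_sum, of "A \<union> F"] F A pi_nonneg
        by (simp add: sum.subset_diff[of F "A \<union> F"] Un_Diff)
      moreover have "sum \<pi> F - sum (p n) F \<le> (\<Sum>x\<in>F. \<bar>p n x - \<pi> x\<bar>)"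
        by (simp add: sum_mono flip: sum_subtractf)
      moreover have "(\<Sum>x\<in>A. \<bar>p n x - \<pi> x\<bar>) \<le> (\<Sum>x\<in>A \<union> F. \<bar>p n x - \<pi> x\<bar>)"
        using F A by (intro sum_mono2) auto
      moreover have "\<dots> = (\<Sum>x\<in>A - F. \<bar>p n x - \<pi> x\<bar>) + (\<Sum>x\<in>F. \<bar>p n x - \<pi> x\<bar>)"
        using F A by (simp add: sum.subset_diff[of F "A \<union> F"] Un_Diff)
      moreover have "(\<Sum>x\<in>A - F. \<bar>p n x - \<pi> x\<bar>) \<le> (\<Sum>x\<in>A - F. p n x + \<pi> x)"
        using A p_nonneg[of n] pi_nonneg by (intro sum_mono) (force simp: abs_le_iff)
      moreover have "\<dots> = sum (p n) (A - F) + sum \<pi> (A - F)" by (rule sum.distrib)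
      ultimately show ?thesis using elim F_sum by linarith
    qed
    have "l1_dist S (p n) \<pi> \<le> ennreal e"
      unfolding l1_dist_def
      by (rule infsum_le_finite_sums[OF nonneg_summable_on_complete])
        (simp_all add: bound ennreal_leI sum_ennreal)
    then show ?case using e e' by simp
  qed
qed simp

context hessenberg_chain
begin

lemma pi_has_sum: "(\<pi> has_sum 1) S"
  using stationary by (simp add: stationary_distribution_def)

lemma sum_pi_le: "finite F \<Longrightarrow> F \<subseteq> S \<Longrightarrow> sum \<pi> F \<le> 1"
  using finite_sum_le_has_sum[OF pi_has_sum] pi_nonneg by blast

text \<open>
  Every subsequential limit is \<open>c \<pi>\<close>, where \<open>c \<ge> 1\<close> because no mass is lost on \<open>A\<close> and
  \<open>c \<le> 1\<close> because the limit is a subprobability.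
\<close>

lemma tendsto_stationary:
  assumes nonneg: "\<And>n x. 0 \<le> p n x" and sum_le: "\<And>n F. finite F \<Longrightarrow> sum (p n) F \<le> 1"
    and bal: "\<And>y. y \<in> S \<Longrightarrow> \<forall>\<^sub>F n in sequentially. balanced (p n) y"
    and A: "finite A" "A \<subseteq> S" "A \<noteq> {}" and mass: "\<And>n. sum \<pi> A \<le> sum (p n) A"
    and "x \<in> S"
  shows "(\<lambda>n. p n x) \<longlonglongrightarrow> \<pi> x"
proof (rule ccontr)
  assume "\<not> (\<lambda>n. p n x) \<longlonglongrightarrow> \<pi> x"
  then obtain e where e: "0 < e" "\<exists>\<^sub>F n in sequentially. e \<le> dist (p n x) (\<pi> x)"
    by (auto simp: tendsto_iff frequently_def not_le)
  then have "infinite {n. e \<le> dist (p n x) (\<pi> x)}"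
    by (simp add: frequently_cofinite cofinite_eq_sequentially[symmetric])
  \<comment> \<open>Along \<open>s\<close> the values at \<open>x\<close> stay away from
    \<open>\<pi> x\<close>; a further subsequence \<open>r\<close> converges at every state, and its
    limit is then shown to agree with \<pi> at \<open>x\<close>.\<close>
  then obtain s :: "nat \<Rightarrow> nat" where s: "strict_mono s" "\<And>n. e \<le> dist (p (s n) x) (\<pi> x)"
    using infinite_enumerate by blast
  have le_1: "p n z \<le> 1" for n z using sum_le[of "{z}" n] by simp
  obtain \<mu> r where r: "strict_mono r" and lim: "\<And>z. (\<lambda>n. p (s (r n)) z) \<longlonglongrightarrow> \<mu> z"
    by (rule subprobability_convergent_subseq[of "\<lambda>n. p (s n)", OF nonneg le_1]) (rule that)
  have mono: "strict_mono (s \<circ> r)" using s(1) r by (rule strict_mono_o)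
  have \<mu>_nonneg: "0 \<le> \<mu> z" for z
    using LIMSEQ_le_const[OF lim, of 0 z] nonneg by blast
  have \<mu>_balanced: "balanced \<mu> y" if "y \<in> S" for y
  proof -
    let ?B = "\<lambda>\<nu>. \<Sum>z\<in>L (Suc (fst y)). \<nu> z * q z y"
    have "\<forall>\<^sub>F n in sequentially. balanced (p ((s \<circ> r) n)) y"
      using eventually_subseq[OF mono bal[OF that]] .
    then have "(\<lambda>n. ?B (p (s (r n)))) \<longlonglongrightarrow> 0"
      by (intro tendsto_eventually) (simp add: balanced_def)
    moreover have "(\<lambda>n. ?B (p (s (r n)))) \<longlonglongrightarrow> ?B \<mu>"
      by (intro tendsto_intros lim)
    ultimately show ?thesis unfolding balanced_def using LIMSEQ_unique by blast
  qed
  obtain c where c: "\<And>z. z \<in> S \<Longrightarrow> \<mu> z = c * \<pi> z"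
    using invariant_measure_unique[of \<mu>] \<mu>_nonneg \<mu>_balanced by blast
  have c_sum: "sum \<mu> F = c * sum \<pi> F" if "F \<subseteq> S" for F
    using c that by (auto simp: sum_distrib_left intro!: sum.cong)
  have lim_sum: "(\<lambda>n. sum (p (s (r n))) F) \<longlonglongrightarrow> sum \<mu> F" for F
    by (intro tendsto_intros lim)
  have "sum \<pi> A \<le> c * sum \<pi> A"
    using LIMSEQ_le_const[OF lim_sum, of "sum \<pi> A" A] mass c_sum[OF A(2)] by auto
  moreover have "0 < sum \<pi> A" using A pi_pos by (intro sum_pos) auto
  ultimately have "1 \<le> c" by simp
  have c_le: "c * sum \<pi> F \<le> 1" if "finite F" "F \<subseteq> S" for F
    using LIMSEQ_le_const2[OF lim_sum, of F 1] sum_le[OF that(1)] c_sum[OF that(2)] by auto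
  have "c * 1 \<le> 1"
    by (rule has_sum_le_finite_sums[OF has_sum_cmult_right[OF pi_has_sum]])
      (simp add: c_le flip: sum_distrib_left)
  with \<open>1 \<le> c\<close> have "c = 1" by simp
  then have "\<mu> x = \<pi> x" using c[OF \<open>x \<in> S\<close>] by simp
  with lim[of x] have "(\<lambda>n. dist (p (s (r n)) x) (\<pi> x)) \<longlonglongrightarrow> 0"
    by (simp only: tendsto_dist_iff[symmetric])
  then have "e \<le> 0" using s(2) by (intro LIMSEQ_le_const) auto
  with \<open>0 < e\<close> show False by simp
qed

text \<open>The value 0 off \<open>L n\<close> makes nonnegativity and the bound on finite sums hold
  on the whole type, as the compactness argument requires.\<close>

definition normalized_sojourn :: "nat \<Rightarrow> nat \<Rightarrow> nat \<times> nat \<Rightarrow> real" where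
  "normalized_sojourn n i x = (if x \<in> L n then sojourn n i x / total_sojourn n i else 0)"

lemma normalized_sojourn_nonneg: "i < M n \<Longrightarrow> 0 \<le> normalized_sojourn n i x"
  using sojourn_nonneg[of i n x] total_sojourn_pos[of i n] by (simp add: normalized_sojourn_def)

lemma sum_normalized_sojourn:
  "i < M n \<Longrightarrow> (\<Sum>x\<in>L n. normalized_sojourn n i x) = 1"
  using total_sojourn_pos[of i n]
  by (simp add: normalized_sojourn_def total_sojourn_def flip: sum_divide_distrib)

lemma sum_normalized_sojourn_le:
  assumes "i < M n" "finite F"
  shows "sum (normalized_sojourn n i) F \<le> 1"
proof -
  have "sum (normalized_sojourn n i) F = sum (normalized_sojourn n i) (F \<inter> L n)"
    using assms by (intro sum.mono_neutral_right) (auto simp: normalized_sojourn_def)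
  also have "\<dots> \<le> sum (normalized_sojourn n i) (L n)"
    using assms normalized_sojourn_nonneg by (intro sum_mono2) auto
  finally show ?thesis using sum_normalized_sojourn[OF assms(1)] by simp
qed

text \<open>The only source of \<open>sojourn n i\<close> sits on level \<open>n\<close>, so the
  equations strictly below are homogeneous.\<close>

lemma balanced_normalized_sojourn:
  assumes "i < M n" "y \<in> S" "fst y < n"
  shows "balanced (normalized_sojourn n i) y"
proof -
  have "(\<Sum>x\<in>L (Suc (fst y)). normalized_sojourn n i x * q x y) =
      (\<Sum>x\<in>L n. normalized_sojourn n i x * q x y)"
    using assms by (intro sum_column_truncate[symmetric]) auto
  also have "\<dots> = (\<Sum>x\<in>L n. sojourn n i x * q x y) / total_sojourn n i"
    by (simp add: normalized_sojourn_def sum_divide_distrib)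
  also have "(\<Sum>x\<in>L n. sojourn n i x * q x y) = 0"
    using assms by (subst sojourn_equation) (auto simp: levels_upto_iff)
  finally show ?thesis by (simp add: balanced_def)
qed

text \<open>
  On the levels up to \<open>n\<close>, \<open>\<pi>\<close> is a mixture of the normalized sojourn vectors of the entrance
  phases in \<open>I_plus\<close>, so the best one carries at least as much mass on \<open>K\<close> as \<open>\<pi>\<close> does.
\<close>

lemma stationary_mass_le:
  assumes j: "j \<in> J_star M q K n" and K: "K \<subseteq> {..n}"
  shows "sum \<pi> {x \<in> L n. fst x \<in> K} \<le> sum (normalized_sojourn n j) {x \<in> L n. fst x \<in> K}"
proof -
  define A where "A = {x \<in> L n. fst x \<in> K}"
  define uK where "uK i = sum (sojourn n i) A" for i
  have "A \<subseteq> L n" by (auto simp: A_def)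
  have I_plus_lt: "i < M n" if "i \<in> I_plus M q n" for i using that by (simp add: I_plus_def)
  have "j \<in> I_plus M q n" and max: "\<And>i. i \<in> I_plus M q n \<Longrightarrow>
      u_star_on M q K n $ i / u_star M q n $ i \<le> u_star_on M q K n $ j / u_star M q n $ j"
    using j by (auto simp: J_star_def is_arg_max_def not_less)
  then have "j < M n" using I_plus_lt by blast
  have max': "uK i / total_sojourn n i \<le> uK j / total_sojourn n j" if "i \<in> I_plus M q n" for i
    using max[OF that] I_plus_lt[OF that] \<open>j < M n\<close> K
    by (simp add: u_star_eq u_star_on_eq uK_def A_def)
  define \<rho> where "\<rho> = uK j / total_sojourn n j"
  have "0 \<le> \<rho>"
    using sojourn_nonneg[OF \<open>j < M n\<close>] \<open>A \<subseteq> L n\<close> total_sojourn_pos[OF \<open>j < M n\<close>]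
    by (auto simp: \<rho>_def uK_def intro!: divide_nonneg_pos sum_nonneg)
  have mix: "sum \<pi> B = (\<Sum>i<M n. inflow n (n, i) * sum (sojourn n i) B)" if "B \<subseteq> L n" for B
  proof -
    have "sum \<pi> B = (\<Sum>x\<in>B. \<Sum>i<M n. inflow n (n, i) * sojourn n i x)"
      using that by (intro sum.cong refl pi_eq_sum_sojourn) auto
    then show ?thesis by (simp add: sum.swap[of _ B] sum_distrib_left)
  qed
  have "sum \<pi> A = (\<Sum>i<M n. inflow n (n, i) * uK i)"
    using mix[OF \<open>A \<subseteq> L n\<close>] by (simp add: uK_def)
  also have "\<dots> \<le> (\<Sum>i<M n. inflow n (n, i) * (\<rho> * total_sojourn n i))"
  proof (rule sum_mono)
    fix i assume "i \<in> {..<M n}"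
    then have i: "i < M n" by simp
    \<comment> \<open>Maximality of \<open>\<rho>\<close> covers only phases in
      \<open>I_plus\<close>; outside it the inflow is 0.\<close>
    show "inflow n (n, i) * uK i \<le> inflow n (n, i) * (\<rho> * total_sojourn n i)"
    proof (cases "inflow n (n, i) = 0")
      case False
      then have "uK i \<le> \<rho> * total_sojourn n i"
        using max'[OF inflow_I_plus[OF i False]] total_sojourn_pos[OF i]
        by (simp add: \<rho>_def pos_divide_le_eq)
      then show ?thesis
        using inflow_nonneg[of "(n, i)" n] i by (intro mult_left_mono) (auto simp: levels_upto_def)
    qed simp
  qed
  also have "\<dots> = \<rho> * sum \<pi> (L n)"
    by (simp add: mix total_sojourn_def sum_distrib_left mult_ac)
  also have "\<dots> \<le> \<rho>"
    using sum_pi_le[OF finite_levels_upto levels_upto_subset] \<open>0 \<le> \<rho>\<close> by (simp add: mult_left_le)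
  also have "\<rho> = sum (normalized_sojourn n j) A"
    using \<open>A \<subseteq> L n\<close>
    by (auto simp: \<rho>_def uK_def normalized_sojourn_def sum_divide_distrib intro!: sum.cong)
  finally show ?thesis by (simp add: A_def)
qed

lemma normalized_sojourn_tendsto:
  assumes K: "finite K" "K \<noteq> {}" and j: "\<And>n. Max K \<le> n \<Longrightarrow> j n \<in> J_star M q K n"
  shows "(\<lambda>n. l1_dist S (normalized_sojourn n (j n)) \<pi>) \<longlonglongrightarrow> 0"
proof -
  define N where "N = Max K"
  \<comment> \<open>The shift by \<open>Max K\<close> makes the choice of \<open>j\<close> valid for
    every index.\<close>
  define p where "p n = normalized_sojourn (n + N) (j (n + N))" for n
  have jlt: "j (n + N) < M (n + N)" for n
    using j[of "n + N"] by (auto simp: N_def J_star_def is_arg_max_def I_plus_def)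
  define A where "A = {x \<in> L N. fst x \<in> K}"
  have K_le: "k \<le> n + N" if "k \<in> K" for k n
    using K Max_ge[OF K(1) that] by (simp add: N_def trans_le_add2)
  have A_eq: "A = {x \<in> L (n + N). fst x \<in> K}" for n
    using K_le[of _ 0] K_le[of _ n] by (auto simp: A_def levels_upto_iff)
  have p_nonneg: "0 \<le> p n x" for n x
    unfolding p_def using normalized_sojourn_nonneg[OF jlt] .
  have p_sum: "sum (p n) F \<le> 1" if "finite F" for n F
    unfolding p_def using sum_normalized_sojourn_le[OF jlt that] .
  have "(\<lambda>n. p n x) \<longlonglongrightarrow> \<pi> x" if "x \<in> S" for x
  proof (rule tendsto_stationary[OF p_nonneg p_sum _ _ _ _ _ that])
    show "\<forall>\<^sub>F n in sequentially. balanced (p n) y" if "y \<in> S" for y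
      using eventually_gt_at_top[of "fst y"]
      by eventually_elim (auto simp: p_def intro!: balanced_normalized_sojourn jlt that)
    show "finite A" "A \<subseteq> S" using levels_upto_subset by (auto simp: A_def)
    have "(N, 0) \<in> A"
      using K M_pos[of N] by (simp add: A_def levels_upto_def) (simp add: N_def)
    then show "A \<noteq> {}" by auto
    show "sum \<pi> A \<le> sum (p n) A" for n
      unfolding p_def A_eq[of n] using K_le[of _ n] by (intro stationary_mass_le j) (auto simp: N_def)
  qed auto
  then have "(\<lambda>n. l1_dist S (p n) \<pi>) \<longlonglongrightarrow> 0"
    by (intro scheffe_l1_dist p_nonneg p_sum pi_nonneg pi_has_sum)
  then show ?thesis unfolding p_def by (rule LIMSEQ_offset)
qed

end

section \<open>Matrix forms of the approximation\<close>

lemma row_vec_mult_unit_vec: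
  assumes "A \<in> carrier_mat n m" "i < n"
  shows "row_vec_mult (unit_vec n i) A = row A i"
  using assms by (intro eq_vecI) (auto simp: row_vec_mult_def)

lemma row_vec_mult_assoc:
  assumes "v \<in> carrier_vec n" "A \<in> carrier_mat n m" "B \<in> carrier_mat m r"
  shows "row_vec_mult (row_vec_mult v A) B = row_vec_mult v (A * B)"
  unfolding row_vec_mult_def transpose_mult[OF assms(2,3)]
  using assms by (intro assoc_mult_mat_vec[symmetric]) auto

lemma row_vec_mult_scalar_prod:
  assumes "v \<in> carrier_vec n" "A \<in> carrier_mat n m" "w \<in> carrier_vec m"
  shows "row_vec_mult v A \<bullet> w = v \<bullet> (A *\<^sub>v w)"
  using transpose_vec_mult_scalar[OF assms(2,3,1)] assms
  by (simp add: row_vec_mult_def comm_scalar_prod[of _ m])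

context hessenberg_chain
begin

lemma u_star_carrier [simp]: "u_star M q n \<in> carrier_vec (M n)"
  by (simp add: u_star_def u_star_on_def)

text \<open>The left factor \<open>U n\<close> is common to all summands and can be pulled out, as
  the second form of the limit demands.\<close>

lemma u_star_factor:
  "u_star M q n = U n *\<^sub>v vec (M n) (\<lambda>i. \<Sum>l\<in>{0..n}. (D n l *\<^sub>v ones_vec (M l)) $ i)"
proof (rule eq_vecI)
  fix i assume "i < dim_vec (U n *\<^sub>v vec (M n) (\<lambda>i. \<Sum>l\<in>{0..n}. (D n l *\<^sub>v ones_vec (M l)) $ i))"
  then have i: "i < M n" using U_star_carrier[of n] by simp
  have "(U_star2 M q n l *\<^sub>v ones_vec (M l)) $ i =
      (\<Sum>k<M n. U n $$ (i, k) * (D n l *\<^sub>v ones_vec (M l)) $ k)" if "l \<le> n" for l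
  proof -
    have "U_star2 M q n l *\<^sub>v ones_vec (M l) = U n *\<^sub>v (D n l *\<^sub>v ones_vec (M l))"
      unfolding U_star2_def
      by (rule assoc_mult_mat_vec[OF U_star_carrier down_prod_U_carrier[OF that]])
        (simp add: ones_vec_def)
    then show ?thesis
      using i U_star_carrier[of n] down_prod_U_carrier[OF that]
      by (simp add: scalar_prod_def[of "row (U n) i"] lessThan_atLeast0)
  qed
  then have "u_star M q n $ i =
      (\<Sum>l\<in>{0..n}. \<Sum>k<M n. U n $$ (i, k) * (D n l *\<^sub>v ones_vec (M l)) $ k)"
    using i by (simp add: u_star_def u_star_on_def)
  also have "\<dots> = (\<Sum>k<M n. U n $$ (i, k) * (\<Sum>l\<in>{0..n}. (D n l *\<^sub>v ones_vec (M l)) $ k))"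
    by (subst sum.swap) (simp add: sum_distrib_left)
  also have "\<dots> = (U n *\<^sub>v vec (M n) (\<lambda>i. \<Sum>l\<in>{0..n}. (D n l *\<^sub>v ones_vec (M l)) $ i)) $ i"
    using i U_star_carrier[of n] by (simp add: scalar_prod_def[of "row (U n) i"] lessThan_atLeast0)
  finally show "u_star M q n $ i =
      (U n *\<^sub>v vec (M n) (\<lambda>i. \<Sum>l\<in>{0..n}. (D n l *\<^sub>v ones_vec (M l)) $ i)) $ i" .
qed (use U_star_carrier[of n] in \<open>simp add: u_star_def u_star_on_def\<close>)

lemma pi_hat_unit_vec:
  assumes "i < M n" "k \<le> n"
  shows "pi_hat M q n (unit_vec (M n) i) k = (1 / u_star M q n $ i) \<cdot>\<^sub>v row (U_star2 M q n k) i"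
  using assms row_vec_mult_unit_vec[OF U_star2_carrier[OF assms(2)] assms(1)]
  by (simp add: pi_hat_def scalar_prod_left_unit[OF u_star_carrier])

lemma pi_hat_factor:
  assumes "\<alpha> \<in> carrier_vec (M n)" "k \<le> n"
  shows "pi_hat M q n \<alpha> k =
    (1 / (row_vec_mult \<alpha> (U n) \<bullet> vec (M n) (\<lambda>i. \<Sum>l\<in>{0..n}. (D n l *\<^sub>v ones_vec (M l)) $ i)))
      \<cdot>\<^sub>v row_vec_mult (row_vec_mult \<alpha> (U n)) (D n k)"
  unfolding pi_hat_def u_star_factor U_star2_def
    row_vec_mult_assoc[OF assms(1) U_star_carrier down_prod_U_carrier[OF assms(2)]]
  by (subst row_vec_mult_scalar_prod[OF assms(1) U_star_carrier]) auto

text \<open>Connects the matrix definition with the function for which convergence was proved.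
  Agreement on \<open>S\<close> suffices, since \<open>l1_dist\<close> sums over \<open>S\<close>
  only.\<close>

lemma zero_extend_pi_hat:
  assumes "i < M n" "x \<in> S"
  shows "zero_extend n (pi_hat M q n (unit_vec (M n) i)) x = normalized_sojourn n i x"
proof (cases "fst x \<le> n")
  case True
  then have "U_star2 M q n (fst x) \<in> carrier_mat (M n) (M (fst x))" by (rule U_star2_carrier)
  then show ?thesis
    using assms True
    by (cases x) (auto simp: zero_extend_def normalized_sojourn_def pi_hat_unit_vec u_star_eq
        sojourn_def levels_upto_iff state_space_def)
qed (cases x, simp add: zero_extend_def normalized_sojourn_def levels_upto_iff)

end

lemma l1_dist_cong: "(\<And>x. x \<in> S \<Longrightarrow> a x = a' x) \<Longrightarrow> l1_dist S a b = l1_dist S a' b"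
  unfolding l1_dist_def by (intro infsum_cong) simp

theorem theorem3p4:
  fixes M :: "nat \<Rightarrow> nat"
    and q :: "nat \<times> nat \<Rightarrow> nat \<times> nat \<Rightarrow> real"
    and \<pi> :: "nat \<times> nat \<Rightarrow> real"
    and KK :: "nat set"
    and j :: "nat \<Rightarrow> nat"
    and \<alpha> :: "nat \<Rightarrow> real vec"
  assumes "\<forall>k. 1 \<le> M k"
    and "essential_Q_matrix (state_space M) q"
    and "upper_block_hessenberg M q"
    and "ergodic_Q (state_space M) q"
    and "stationary_distribution (state_space M) q \<pi>"
    and "finite KK" and "KK \<noteq> {}"
    and "\<forall>n\<ge>Max KK. j n \<in> J_star M q KK n"
    and "\<forall>n\<ge>Max KK. \<alpha> n = unit_vec (M n) (j n)"
  shows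
    "(\<forall>n\<ge>Max KK. \<forall>k\<le>n.
        pi_hat M q n (\<alpha> n) k = (1 / u_star M q n $ j n) \<cdot>\<^sub>v row (U_star2 M q n k) (j n)) \<and>
     (\<lambda>n. l1_dist (state_space M) (zero_extend n (pi_hat M q n (\<alpha> n))) \<pi>)
        \<longlonglongrightarrow> 0 \<and>
     (\<lambda>n. l1_dist (state_space M)
        (zero_extend n (\<lambda>k.
           (1 / (row_vec_mult (\<alpha> n) (U_star M q n) \<bullet>
                 vec (M n) (\<lambda>i. \<Sum>l\<in>{0..n}.
                   (down_prod M (U_mat M q) n l *\<^sub>v ones_vec (M l)) $ i)))
             \<cdot>\<^sub>v row_vec_mult (row_vec_mult (\<alpha> n) (U_star M q n)) (down_prod M (U_mat M q) n k)))
        \<pi>) \<longlonglongrightarrow> 0"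
proof -
  interpret hessenberg_chain M q \<pi> using assms by unfold_locales auto
  let ?p = "\<lambda>n. l1_dist S (zero_extend n (pi_hat M q n (\<alpha> n))) \<pi>"
  have j: "j n \<in> J_star M q KK n" and \<alpha>: "\<alpha> n = unit_vec (M n) (j n)" if "Max KK \<le> n" for n
    using assms that by auto
  have jlt: "j n < M n" if "Max KK \<le> n" for n
    using j[OF that] by (auto simp: J_star_def is_arg_max_def I_plus_def)
  \<comment> \<open>Only an eventual equality, because \<open>j n\<close> and
    \<open>\<alpha> n\<close> are arbitrary for \<open>n < Max KK\<close>.\<close>
  have "\<forall>\<^sub>F n in sequentially. l1_dist S (normalized_sojourn n (j n)) \<pi> = ?p n"
    using eventually_ge_at_top[of "Max KK"]
    by eventually_elim (intro l1_dist_cong, simp add: \<alpha> zero_extend_pi_hat jlt)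
  then have lim: "?p \<longlonglongrightarrow> 0"
    using normalized_sojourn_tendsto[OF assms(6,7) j] by (rule Lim_transform_eventually[rotated])
  have "\<forall>\<^sub>F n in sequentially. ?p n = l1_dist S (zero_extend n (\<lambda>k.
      (1 / (row_vec_mult (\<alpha> n) (U n) \<bullet> vec (M n) (\<lambda>i. \<Sum>l\<in>{0..n}. (D n l *\<^sub>v ones_vec (M l)) $ i)))
        \<cdot>\<^sub>v row_vec_mult (row_vec_mult (\<alpha> n) (U n)) (D n k))) \<pi>"
    using eventually_ge_at_top[of "Max KK"]
  proof eventually_elim
    case (elim n)
    have "\<alpha> n \<in> carrier_vec (M n)" using \<alpha>[OF elim] by simp
    note factor = pi_hat_factor[OF this]
    show ?case
    proof (rule l1_dist_cong, clarify)
      fix k i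
      show "zero_extend n (pi_hat M q n (\<alpha> n)) (k, i) = zero_extend n (\<lambda>k.
          (1 / (row_vec_mult (\<alpha> n) (U n) \<bullet>
                vec (M n) (\<lambda>i. \<Sum>l\<in>{0..n}. (D n l *\<^sub>v ones_vec (M l)) $ i)))
            \<cdot>\<^sub>v row_vec_mult (row_vec_mult (\<alpha> n) (U n)) (D n k)) (k, i)"
        by (cases "k \<le> n") (simp_all only: zero_extend_def prod.case if_True if_False factor)
    qed
  qed
  with lim have lim': "(\<lambda>n. l1_dist S (zero_extend n (\<lambda>k.
      (1 / (row_vec_mult (\<alpha> n) (U n) \<bullet> vec (M n) (\<lambda>i. \<Sum>l\<in>{0..n}. (D n l *\<^sub>v ones_vec (M l)) $ i)))
        \<cdot>\<^sub>v row_vec_mult (row_vec_mult (\<alpha> n) (U n)) (D n k))) \<pi>) \<longlonglongrightarrow> 0"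
    by (rule Lim_transform_eventually)
  have "\<forall>n\<ge>Max KK. \<forall>k\<le>n.
      pi_hat M q n (\<alpha> n) k = (1 / u_star M q n $ j n) \<cdot>\<^sub>v row (U_star2 M q n k) (j n)"
  proof (intro allI impI)
    fix n k assume "Max KK \<le> n" "k \<le> n"
    then show "pi_hat M q n (\<alpha> n) k = (1 / u_star M q n $ j n) \<cdot>\<^sub>v row (U_star2 M q n k) (j n)"
      using pi_hat_unit_vec[OF jlt] \<alpha> by (simp only:)
  qed
  with lim lim' show ?thesis by (intro conjI)
qed

end
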